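(* Let $k\ge1$ and let $X(n)=\sum'_{0<i_1,\ldots,i_k<\infty}a(i_1,\ldots,i_k)\epsilon_{n-i_1}\cdots\epsilon_{n-i_k}$, $n\in\mathbb{Z}$, be a causal discrete chaos process with $a(\mathbf{i})=g(\mathbf{i})L(\mathbf{i})$, where $g$ is a generalized Hermite kernel of Class (L) with homogeneity exponent $\alpha\in(-\frac12-\frac k2,-\frac k2)$ (that is, $2\alpha+k\in(-1,0)$), and $L$ is an admissible factor. Then the autocovariance $\gamma(n)=\mathrm{Cov}(X(n),X(0))$ satisfies $$\gamma(n)\sim k!\,C_{\tilde g}\,n^{2H-2}\quad\text{as }n\to\infty,$$ where $C_{\tilde g}=\int_{\mathbb{R}_+^k}\tilde g(\mathbf{x})\tilde g(\mathbf{1}+\mathbf{x})\,d\mathbf{x}>0$ and $H=\alpha+k/2+1\in(1/2,1)$, with $\tilde g$ being the symmetrization of $g$. In addition, as $N\to\infty$, $$\mathrm{Var}\left[\sum_{n=1}^NX(n)\right]\sim\frac{k!\,C_{\tilde g}}{H(2H-1)}N^{2H}.$$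
   Context: Notation: $\mathbb{R}_+=(0,\infty)$, $\mathbb{Z}_+=\{1,2,\ldots\}$, $\mathbf{1}=(1,\ldots,1)$; $[\mathbf{x}]$ is the componentwise integer part (floor). A prime on a sum over $(i_1,\ldots,i_k)$ means that the diagonals $i_p=i_q$, $p\ne q$, are excluded. The symmetrization of a function $f$ of $k$ variables is $\tilde f(x_1,\ldots,x_k)=\frac1{k!}\sum_\sigma f(x_{\sigma(1)},\ldots,x_{\sigma(k)})$, sum over permutations $\sigma$ of $(1,\ldots,k)$. $\{\epsilon_i\}_{i\in\mathbb{Z}}$ is an i.i.d. sequence with mean $0$ and variance $1$. In the definition of a causal discrete chaos process the coefficients are required to satisfy $\sum'_{\mathbf{i}\in\mathbb{Z}_+^k}a(\mathbf{i})^2<\infty$, so that $X(n)$ is well-defined in $L^2(\Omega)$. A generalized Hermite kernel of order $k$ is a nonzero measurable function $g:\mathbb{R}_+^k\to\mathbb{R}$ such that (A) $g(\lambda\mathbf{x})=\lambda^\alpha g(\mathbf{x})$ for all $\lambda>0$, where $\alpha\in(-\frac{k+1}{2},-\frac{k}{2})$ (homogeneity exponent); (B) $\int_{\mathbb{R}_+^k}|g(\mathbf{x})g(\mathbf{1}+\mathbf{x})|\,d\mathbf{x}<\infty$. Class (L): such a $g$ is of Class (L) if (1) $g$ is continuous a.e. on $\mathbb{R}_+^k$; (2) $|g(\mathbf{x})|\le g^*(\mathbf{x})$ for a.e. $\mathbf{x}\in\mathbb{R}_+^k$, where $g^*$ is a finite linear combination of functions $\prod_{j=1}^kx_j^{\gamma_j}$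 with $\gamma_j\in(-1,-1/2)$ and $\sum_{j=1}^k\gamma_j=\alpha$ (the $\gamma_j$ may differ from term to term). Admissible factor: a bounded function $L$ on $\mathbb{Z}_+^k$ such that for every $\mathbf{x}\in\mathbb{R}_+^k$ and every bounded $\mathbb{Z}^k$-valued function $\mathbf{B}(\cdot)$ on $\mathbb{Z}_+$, $L([n\mathbf{x}]+\mathbf{B}(n))\to1$ as $n\to\infty$.
   Formalization: Two assumptions are added, as the claim fails without them: the symmetrization of g is not a.e. zero (else C=0), and |g| is bounded by a majorant of the Class (L) form also at the off-diagonal positive integer points, not only almost everywhere. *)

theory Defs
  imports "HOL-Probability.Probability"
begin

text \<open>
  The order \<open>k \<ge> 1\<close> is \<open>CARD('k)\<close> for a finite index type \<open>'k\<close>. Functions on the open orthant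
  are total functions on \<open>real ^ 'k\<close>, and functions on the positive lattice points are total
  functions on \<open>int ^ 'k\<close>; their values elsewhere are irrelevant.
\<close>

definition pos_orthant :: "(real ^ 'k::finite) set" where
  "pos_orthant = {x. \<forall>j. 0 < x $ j}"

definition pos_lattice :: "(int ^ 'k::finite) set" where
  "pos_lattice = {i. \<forall>j. 0 < i $ j}"

definition offdiag_lattice :: "(int ^ 'k::finite) set" where
  "offdiag_lattice = {i \<in> pos_lattice. \<forall>p q. p \<noteq> q \<longrightarrow> i $ p \<noteq> i $ q}"

definition real_vec :: "int ^ 'k \<Rightarrow> real ^ 'k::finite" where
  "real_vec i = (\<chi> j. real_of_int (i $ j))"

definition floor_vec :: "real ^ 'k \<Rightarrow> int ^ 'k::finite" where
  "floor_vec x = (\<chi> j. \<lfloor>x $ j\<rfloor>)"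

definition symmetrization :: "(real ^ 'k \<Rightarrow> real) \<Rightarrow> real ^ 'k::finite \<Rightarrow> real" where
  "symmetrization f x =
     1 / fact CARD('k) * (\<Sum>\<sigma> | \<sigma> permutes (UNIV :: 'k set). f (\<chi> j. x $ \<sigma> j))"

text \<open>Measurability and null sets refer to Lebesgue measure; a nonzero kernel is one that is not
  almost everywhere zero. The vector \<open>1\<close> has all components equal to 1.\<close>

definition generalized_hermite_kernel :: "real \<Rightarrow> (real ^ 'k::finite \<Rightarrow> real) \<Rightarrow> bool" where
  "generalized_hermite_kernel \<alpha> g \<longleftrightarrow>
     g \<in> borel_measurable (lebesgue_on pos_orthant) \<and>
     \<not> (AE x in lebesgue. x \<in> pos_orthant \<longrightarrow> g x = 0) \<and>
     \<alpha> \<in> {- (real CARD('k) + 1) / 2 <..< - real CARD('k) / 2} \<and>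
     (\<forall>c>0. \<forall>x\<in>pos_orthant. g (c *\<^sub>R x) = c powr \<alpha> * g x) \<and>
     set_integrable lebesgue pos_orthant (\<lambda>x. \<bar>g x * g (1 + x)\<bar>)"

definition class_L_majorant :: "real \<Rightarrow> (real ^ 'k::finite \<Rightarrow> real) \<Rightarrow> bool" where
  "class_L_majorant \<alpha> h \<longleftrightarrow>
     (\<exists>(m::nat) (c :: nat \<Rightarrow> real) (\<gamma> :: nat \<Rightarrow> 'k \<Rightarrow> real).
        (\<forall>l<m. (\<forall>j. \<gamma> l j \<in> {-1 <..< -1/2}) \<and> (\<Sum>j\<in>UNIV. \<gamma> l j) = \<alpha>) \<and>
        (\<forall>x\<in>pos_orthant. h x = (\<Sum>l<m. c l * (\<Prod>j\<in>UNIV. x $ j powr \<gamma> l j))))"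

definition class_L :: "real \<Rightarrow> (real ^ 'k::finite \<Rightarrow> real) \<Rightarrow> bool" where
  "class_L \<alpha> g \<longleftrightarrow>
     (AE x in lebesgue. x \<in> pos_orthant \<longrightarrow> continuous (at x within pos_orthant) g) \<and>
     (\<exists>h. class_L_majorant \<alpha> h \<and> (AE x in lebesgue. x \<in> pos_orthant \<longrightarrow> \<bar>g x\<bar> \<le> h x))"

text \<open>
  The bound in \<^const>\<open>class_L\<close> holds only almost everywhere, so by itself it says nothing about the
  values of \<open>g\<close> at the lattice points, which are the values that enter a discrete chaos process.
  The next condition supplies the bound at these points.
\<close>

definition lattice_dominated :: "real \<Rightarrow> (real ^ 'k::finite \<Rightarrow> real) \<Rightarrow> bool" where
  "lattice_dominated \<alpha> g \<longleftrightarrow>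
     (\<exists>h. class_L_majorant \<alpha> h \<and> (\<forall>i\<in>offdiag_lattice. \<bar>g (real_vec i)\<bar> \<le> h (real_vec i)))"

text \<open>For each \<open>x\<close> the argument of \<open>L\<close> below lies in \<^const>\<open>pos_lattice\<close> for all but finitely
  many \<open>n\<close>.\<close>

definition admissible_factor :: "(int ^ 'k::finite \<Rightarrow> real) \<Rightarrow> bool" where
  "admissible_factor L \<longleftrightarrow>
     (\<exists>K. \<forall>i\<in>pos_lattice. \<bar>L i\<bar> \<le> K) \<and>
     (\<forall>x\<in>pos_orthant. \<forall>B :: nat \<Rightarrow> int ^ 'k. (\<exists>b. \<forall>n j. \<bar>B n $ j\<bar> \<le> b) \<longrightarrow>
        (\<lambda>n. L (floor_vec (real n *\<^sub>R x) + B n)) \<longlonglongrightarrow> 1)"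

definition iid_standardized :: "'a measure \<Rightarrow> (int \<Rightarrow> 'a \<Rightarrow> real) \<Rightarrow> bool" where
  "iid_standardized M \<epsilon> \<longleftrightarrow>
     prob_space.indep_vars M (\<lambda>_. borel) \<epsilon> UNIV \<and>
     (\<forall>i. distr M borel (\<epsilon> i) = distr M borel (\<epsilon> 0)) \<and>
     (\<forall>i. integrable M (\<lambda>\<omega>. (\<epsilon> i \<omega>)\<^sup>2) \<and>
          prob_space.expectation M (\<epsilon> i) = 0 \<and> prob_space.variance M (\<epsilon> i) = 1)"

text \<open>
  \<open>X n\<close> is a version of the (unordered) sum in \<open>L\<^sup>2\<close> of \<open>a(i) \<epsilon>\<^bsub>n-i\<^sub>1\<^esub> \<dots> \<epsilon>\<^bsub>n-i\<^sub>k\<^esub>\<close> over all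
  positive multi-indices with pairwise distinct components, that is, the mean-square limit of
  the partial sums along the net of finite index sets. Square summability of the coefficients
  makes this limit exist.
\<close>

definition causal_discrete_chaos ::
    "'a measure \<Rightarrow> (int \<Rightarrow> 'a \<Rightarrow> real) \<Rightarrow> (int ^ 'k::finite \<Rightarrow> real) \<Rightarrow> (int \<Rightarrow> 'a \<Rightarrow> real) \<Rightarrow> bool"
  where
  "causal_discrete_chaos M \<epsilon> a X \<longleftrightarrow>
     (\<lambda>i. (a i)\<^sup>2) summable_on offdiag_lattice \<and>
     (\<forall>n. X n \<in> borel_measurable M \<and> integrable M (\<lambda>\<omega>. (X n \<omega>)\<^sup>2) \<and>
        ((\<lambda>F. prob_space.expectation M
                (\<lambda>\<omega>. (X n \<omega> - (\<Sum>i\<in>F. a i * (\<Prod>j\<in>UNIV. \<epsilon> (n - i $ j) \<omega>)))\<^sup>2))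
           \<longlongrightarrow> 0) (finite_subsets_at_top offdiag_lattice))"

definition covariance :: "'a measure \<Rightarrow> ('a \<Rightarrow> real) \<Rightarrow> ('a \<Rightarrow> real) \<Rightarrow> real" where
  "covariance M Y Z = prob_space.expectation M
     (\<lambda>\<omega>. (Y \<omega> - prob_space.expectation M Y) * (Z \<omega> - prob_space.expectation M Z))"

definition kernel_constant :: "(real ^ 'k::finite \<Rightarrow> real) \<Rightarrow> real" where
  "kernel_constant f = (LINT x:pos_orthant|lebesgue. f x * f (1 + x))"

end

theory Submission
  imports Defs "HOL-Real_Asymp.Real_Asymp"
begin

text \<open>
  Write \<open>a(i) = g(i) L(i)\<close> and let \<open>A\<close> be its symmetrization. A product of noise variables
  \<open>\<epsilon>\<^bsub>n-i\<^sub>1\<^esub> \<dots> \<epsilon>\<^bsub>n-i\<^sub>k\<^esub>\<close> over distinct indices has mean 0, and two such products are uncorrelated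
  unless they involve the same set of indices, that is, unless the two (shifted) multi-indices are
  permutations of each other. Hence
  \<open>Cov(X(m+n), X(m)) = k! R(n)\<close> with \<open>R(n) = \<Sum>\<^sub>i A(i) A(i+n)\<close>, summed over positive multi-indices
  with distinct entries (\<open>expectation_X_mult_X\<close>, \<open>has_sum_symmetrize\<close>).

  The sum \<open>R(n)\<close> is a Riemann sum on the grid of mesh \<open>1/n\<close>: it equals \<open>n\<^sup>k\<close> times the integral of
  \<open>A(i) A(i+n)\<close> with \<open>i = [nx] + 1\<close>. By homogeneity \<open>n\<^bsup>-\<alpha>\<^esup> A([nx] + 1)\<close> is the symmetrized kernel at a
  point within \<open>1/n\<close> of \<open>x\<close> in each coordinate, up to factors tending to 1 in its terms, so it
  converges for almost every \<open>x\<close>. The grid point \<open>([nx] + 1)/n\<close> lies above \<open>x\<close> and the majorant, a sum \<open>S\<close> of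
  products of negative powers, is decreasing; so \<open>S(x) S(1+x)\<close> dominates all the integrands at
  once. It is integrable because it splits into one-dimensional integrals of \<open>t\<^sup>\<gamma> (1+t)\<^bsup>\<gamma>'\<^esup>\<close> with
  \<open>\<gamma>, \<gamma>'\<close> between \<open>-1\<close> and \<open>-1/2\<close>. Dominated convergence (\<open>R_asymptotics\<close>) gives
  \<open>R(n) / n\<^bsup>2H-2\<^esup> \<longrightarrow> C\<close>.

  The variance of the partial sum is \<open>k! V(N)\<close> with \<open>V(N) = \<Sum>\<^bsub>n,m\<le>N\<^esub> R(|n-m|)\<close>. Its increments are
  \<open>R(0) + 2 \<Sum>\<^bsub>d\<le>N\<^esub> R(d)\<close>, so two applications of the Stolz-Cesaro theorem turn the limit of
  \<open>R(n) / n\<^bsup>2H-2\<^esup>\<close> into \<open>V(N) / N\<^bsup>2H\<^esup> \<longrightarrow> C / (H(2H-1))\<close> (\<open>variance_sum_asymptotics\<close>).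

  It remains to see that \<open>C > 0\<close>. Take \<open>L = 1\<close>, which does not change \<open>C\<close>. Now \<open>V(N)\<close> is a sum of
  squares \<open>(\<Sum>\<^bsub>n\<le>N\<^esub> A(i+n))\<^sup>2\<close> over all integer multi-indices \<open>i\<close>, where \<open>A\<close>
  is extended by 0. The symmetrized kernel is continuous
  and nonzero at some point with distinct coordinates, hence has constant sign and is bounded away
  from 0 on a small box there, and homogeneity spreads this bound over proportional boxes at every
  scale. That yields \<open>N\<^sup>k\<close> multi-indices, at each of which the inner sum has order at least
  \<open>N\<^bsup>1+\<alpha>\<^esup>\<close>. So \<open>V(N) \<ge> c N\<^bsup>k+2+2\<alpha>\<^esup> = c N\<^bsup>2H\<^esup>\<close> with \<open>c > 0\<close>, and \<open>C\<close> cannot vanish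
  (\<open>kernel_constant_pos\<close>).
\<close>

section \<open>Second moments of chaos processes\<close>

lemma integrable_mult_of_square_integrable:
  fixes Y Z :: "'a \<Rightarrow> real"
  assumes [measurable]: "Y \<in> borel_measurable M" "Z \<in> borel_measurable M"
    and sq: "integrable M (\<lambda>x. (Y x)\<^sup>2)" "integrable M (\<lambda>x. (Z x)\<^sup>2)"
  shows "integrable M (\<lambda>x. Y x * Z x)"
proof (rule Bochner_Integration.integrable_bound)
  show "integrable M (\<lambda>x. (Y x)\<^sup>2 + (Z x)\<^sup>2)"
    using sq by simp
  have "\<bar>y * z\<bar> \<le> y\<^sup>2 + z\<^sup>2" for y z :: real
  proof -
    have "0 \<le> \<bar>y\<bar> * \<bar>z\<bar>" by simp
    moreover have "2 * (\<bar>y\<bar> * \<bar>z\<bar>) \<le> y\<^sup>2 + z\<^sup>2"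
      using sum_squares_bound[of "\<bar>y\<bar>" "\<bar>z\<bar>"] by simp
    ultimately show ?thesis
      unfolding abs_mult by linarith
  qed
  then show "AE x in M. norm (Y x * Z x) \<le> norm ((Y x)\<^sup>2 + (Z x)\<^sup>2)"
    by simp
qed simp

text \<open>The error \<open>\<integral> Z (Y - S)\<close> is at most \<open>(\<eta> \<integral> Z\<^sup>2 + \<integral> (Y - S)\<^sup>2 / \<eta>) / 2\<close> for every \<open>\<eta> > 0\<close>; fix \<open>\<eta>\<close>
  small first, then let \<open>S\<close> approach \<open>Y\<close> in \<open>L\<^sup>2\<close>.\<close>
lemma tendsto_integral_mult_of_L2:
  fixes Y Z :: "'a \<Rightarrow> real" and S :: "'b \<Rightarrow> 'a \<Rightarrow> real"
  assumes meas [measurable]: "Y \<in> borel_measurable M" "Z \<in> borel_measurable M"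
      "\<And>i. S i \<in> borel_measurable M"
    and sq: "integrable M (\<lambda>x. (Y x)\<^sup>2)" "integrable M (\<lambda>x. (Z x)\<^sup>2)"
      "\<And>i. integrable M (\<lambda>x. (S i x)\<^sup>2)"
    and lim: "((\<lambda>i. \<integral>x. (Y x - S i x)\<^sup>2 \<partial>M) \<longlongrightarrow> 0) F"
  shows "((\<lambda>i. \<integral>x. Z x * S i x \<partial>M) \<longlongrightarrow> (\<integral>x. Z x * Y x \<partial>M)) F"
proof -
  define A where "A = (\<integral>x. (Z x)\<^sup>2 \<partial>M) + 1"
  have A: "A > 0" "(\<integral>x. (Z x)\<^sup>2 \<partial>M) < A"
    by (simp_all add: A_def add_nonneg_pos)
  have intYS: "integrable M (\<lambda>x. (Y x - S i x)\<^sup>2)" for i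
  proof -
    have "integrable M (\<lambda>x. 2 * (Y x * S i x))"
      using sq integrable_mult_of_square_integrable[of Y M "S i"] by simp
    then show ?thesis
      using sq unfolding power2_diff
      by (intro Bochner_Integration.integrable_diff Bochner_Integration.integrable_add)
        (simp_all add: mult.assoc)
  qed
  have ints: "integrable M (\<lambda>x. Z x * S i x)" "integrable M (\<lambda>x. Z x * Y x)" for i
    by (intro integrable_mult_of_square_integrable sq; measurable)+
  have bound: "\<bar>\<integral>x. Z x * S i x \<partial>M - \<integral>x. Z x * Y x \<partial>M\<bar>
      \<le> (\<eta> * (\<integral>x. (Z x)\<^sup>2 \<partial>M) + (\<integral>x. (Y x - S i x)\<^sup>2 \<partial>M) / \<eta>) / 2" if "\<eta> > 0" for i \<eta>
  proof -
    have am: "\<bar>z * s - z * y\<bar> \<le> (\<eta> * z\<^sup>2 + (y - s)\<^sup>2 / \<eta>) / 2" for z y s :: real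
    proof -
      have "2 * \<bar>z\<bar> * \<bar>y - s\<bar> \<le> \<eta> * z\<^sup>2 + (y - s)\<^sup>2 / \<eta>"
        using sum_squares_bound[of "sqrt \<eta> * \<bar>z\<bar>" "\<bar>y - s\<bar> / sqrt \<eta>"] that
        by (simp add: power_mult_distrib power_divide)
      moreover have "\<bar>z * s - z * y\<bar> = \<bar>z\<bar> * \<bar>y - s\<bar>"
        by (simp add: abs_mult[symmetric] right_diff_distrib abs_minus_commute)
      ultimately show ?thesis by simp
    qed
    have "\<bar>\<integral>x. Z x * S i x \<partial>M - \<integral>x. Z x * Y x \<partial>M\<bar> = \<bar>\<integral>x. Z x * S i x - Z x * Y x \<partial>M\<bar>"
      using ints by simp
    also have "\<dots> \<le> (\<integral>x. \<bar>Z x * S i x - Z x * Y x\<bar> \<partial>M)"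
      by (rule integral_abs_bound)
    also have "\<dots> \<le> (\<integral>x. (\<eta> * (Z x)\<^sup>2 + (Y x - S i x)\<^sup>2 / \<eta>) / 2 \<partial>M)"
      using ints sq intYS by (intro integral_mono am) auto
    also have "\<dots> = (\<eta> * (\<integral>x. (Z x)\<^sup>2 \<partial>M) + (\<integral>x. (Y x - S i x)\<^sup>2 \<partial>M) / \<eta>) / 2"
      using sq intYS by simp
    finally show ?thesis .
  qed
  show ?thesis
  proof (rule tendstoI)
    fix e :: real assume e: "e > 0"
    define \<eta> where "\<eta> = e / A"
    have \<eta>: "\<eta> > 0" using e A by (simp add: \<eta>_def)
    have "\<forall>\<^sub>F i in F. (\<integral>x. (Y x - S i x)\<^sup>2 \<partial>M) < \<eta> * e"
      using order_tendstoD(2)[OF lim] \<eta> e by simp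
    then show "\<forall>\<^sub>F i in F. dist (\<integral>x. Z x * S i x \<partial>M) (\<integral>x. Z x * Y x \<partial>M) < e"
    proof eventually_elim
      case (elim i)
      have "(\<integral>x. (Y x - S i x)\<^sup>2 \<partial>M) / \<eta> < e"
        using elim \<eta> by (simp add: field_simps)
      moreover have "\<eta> * (\<integral>x. (Z x)\<^sup>2 \<partial>M) < e"
        using A e by (simp add: \<eta>_def field_simps)
      ultimately show ?case
        using bound[OF \<eta>, of i] by (simp add: dist_real_def)
    qed
  qed
qed

text \<open>Both products together are one product of independent factors, indexed by \<open>P \<union> Q\<close>. An index in
  the symmetric difference contributes a factor with mean 0, an index in the intersection a factor
  \<open>\<epsilon>\<^sub>t\<^sup>2\<close> with mean 1.\<close>
lemma (in prob_space) expectation_prod_mult_prod: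
  assumes iid: "iid_standardized M \<epsilon>" and fin: "finite P" "finite Q"
  shows "integrable M (\<lambda>\<omega>. (\<Prod>t\<in>P. \<epsilon> t \<omega>) * (\<Prod>t\<in>Q. \<epsilon> t \<omega>))" (is ?int)
    and "expectation (\<lambda>\<omega>. (\<Prod>t\<in>P. \<epsilon> t \<omega>) * (\<Prod>t\<in>Q. \<epsilon> t \<omega>)) = (if P = Q then 1 else 0)" (is ?eq)
proof -
  have ind: "indep_vars (\<lambda>_. borel) \<epsilon> UNIV"
    and sq: "\<And>i. integrable M (\<lambda>\<omega>. (\<epsilon> i \<omega>)\<^sup>2)"
    and mean: "\<And>i. expectation (\<epsilon> i) = 0" and var: "\<And>i. variance (\<epsilon> i) = 1"
    using iid unfolding iid_standardized_def by blast+
  have meas [measurable]: "\<epsilon> i \<in> borel_measurable M" for i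
    using ind by (auto simp: indep_vars_def)
  have int1: "integrable M (\<epsilon> i)" for i
    using integrable_mult_of_square_integrable[of "\<epsilon> i" M "\<lambda>_. 1"] sq by simp
  have sq1: "expectation (\<lambda>\<omega>. \<epsilon> i \<omega> * \<epsilon> i \<omega>) = 1" for i
    using var[of i] by (simp add: mean power2_eq_square)
  define h :: "int \<Rightarrow> real \<Rightarrow> real" where
    "h t y = (if t \<in> P then y else 1) * (if t \<in> Q then y else 1)" for t y
  have h_meas [measurable]: "h t \<in> borel_measurable borel" for t
    unfolding h_def by measurable
  have indh: "indep_vars (\<lambda>_. borel) (\<lambda>t \<omega>. h t (\<epsilon> t \<omega>)) (P \<union> Q)"
    by (rule indep_vars_compose2[OF indep_vars_subset[OF ind]]) auto
  have inth: "integrable M (\<lambda>\<omega>. h t (\<epsilon> t \<omega>))" for t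
    using int1 sq[of t] unfolding h_def
    by (cases "t \<in> P"; cases "t \<in> Q") (simp_all add: power2_eq_square)
  have prod_eq: "(\<Prod>t\<in>P. \<epsilon> t \<omega>) * (\<Prod>t\<in>Q. \<epsilon> t \<omega>) = (\<Prod>t\<in>P \<union> Q. h t (\<epsilon> t \<omega>))" for \<omega>
  proof -
    have "(\<Prod>t\<in>P. \<epsilon> t \<omega>) = (\<Prod>t\<in>P \<union> Q. if t \<in> P then \<epsilon> t \<omega> else 1)"
      "(\<Prod>t\<in>Q. \<epsilon> t \<omega>) = (\<Prod>t\<in>P \<union> Q. if t \<in> Q then \<epsilon> t \<omega> else 1)"
      using fin by (auto intro!: prod.mono_neutral_cong_left)
    then show ?thesis by (simp add: h_def prod.distrib)
  qed
  show ?int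
    unfolding prod_eq using fin indh inth by (intro indep_vars_integrable) auto
  have Eh: "expectation (\<lambda>\<omega>. h t (\<epsilon> t \<omega>)) = (if t \<in> P \<and> t \<in> Q then 1 else 0)" if "t \<in> P \<union> Q" for t
    using that mean[of t] sq1[of t] by (auto simp: h_def)
  have "expectation (\<lambda>\<omega>. (\<Prod>t\<in>P. \<epsilon> t \<omega>) * (\<Prod>t\<in>Q. \<epsilon> t \<omega>))
      = (\<Prod>t\<in>P \<union> Q. expectation (\<lambda>\<omega>. h t (\<epsilon> t \<omega>)))"
    unfolding prod_eq using fin indh inth by (intro indep_vars_lebesgue_integral) auto
  also have "\<dots> = (\<Prod>t\<in>P \<union> Q. if t \<in> P \<and> t \<in> Q then 1 else 0)"
    using Eh by (intro prod.cong) auto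
  also have "\<dots> = (if P = Q then 1 else 0)"
  proof (cases "P = Q")
    case False
    then obtain t where "t \<in> P \<union> Q" "\<not> (t \<in> P \<and> t \<in> Q)" by auto
    with False show ?thesis
      using fin by (auto intro!: prod_zero)
  qed simp
  finally show ?eq .
qed

text \<open>Rearranging coordinates is kept polymorphic because it has to commute with the passage from
  lattice points to real vectors.\<close>
definition perm_vec :: "('k \<Rightarrow> 'k) \<Rightarrow> 'b ^ 'k::finite \<Rightarrow> 'b ^ 'k" where
  "perm_vec \<sigma> x = (\<chi> j. x $ \<sigma> j)"

lemma perm_vec_nth [simp]: "perm_vec \<sigma> x $ j = x $ \<sigma> j"
  by (simp add: perm_vec_def)

abbreviation perms :: "('k::finite \<Rightarrow> 'k) set" where
  "perms \<equiv> {\<sigma>. \<sigma> permutes UNIV}"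

lemma finite_perms [simp]: "finite perms"
  by (rule finite_permutations) simp

definition shift_vec :: "int \<Rightarrow> int ^ 'k \<Rightarrow> int ^ 'k::finite" where
  "shift_vec n i = (\<chi> j. i $ j + n)"

lemma shift_vec_nth [simp]: "shift_vec n i $ j = i $ j + n"
  by (simp add: shift_vec_def)

lemma offdiag_lattice_iff: "i \<in> offdiag_lattice \<longleftrightarrow> (\<forall>j. 0 < i $ j) \<and> inj (\<lambda>j. i $ j)"
  by (auto simp: offdiag_lattice_def pos_lattice_def inj_def)

lemma perm_vec_offdiag:
  assumes "\<sigma> permutes UNIV" "i \<in> offdiag_lattice"
  shows "perm_vec \<sigma> i \<in> offdiag_lattice"
  using assms inj_compose[of "\<lambda>j. i $ j" \<sigma>]
  by (auto simp: offdiag_lattice_iff permutes_inj o_def)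

lemma shift_vec_offdiag:
  assumes "0 \<le> n" "i \<in> offdiag_lattice"
  shows "shift_vec n i \<in> offdiag_lattice"
  using assms by (auto simp: offdiag_lattice_iff inj_def add_pos_nonneg)

lemma inj_on_perm_vec:
  assumes "inj (\<lambda>j. i $ j)"
  shows "inj_on (\<lambda>\<sigma>. perm_vec \<sigma> i) perms"
  using assms by (auto simp: inj_on_def vec_eq_iff inj_def)

lemma range_eq_iff_perm_vec:
  fixes x y :: "'b ^ 'k::finite"
  assumes "inj (\<lambda>j. x $ j)" "inj (\<lambda>j. y $ j)"
  shows "range (\<lambda>j. x $ j) = range (\<lambda>j. y $ j) \<longleftrightarrow> x \<in> (\<lambda>\<sigma>. perm_vec \<sigma> y) ` perms"
proof
  assume eq: "range (\<lambda>j. x $ j) = range (\<lambda>j. y $ j)"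
  then have "\<forall>j. \<exists>l. x $ j = y $ l" by (metis rangeE rangeI)
  then obtain \<sigma> where \<sigma>: "\<And>j. x $ j = y $ \<sigma> j" by metis
  have "inj \<sigma>"
    using assms(1) by (auto simp: inj_def \<sigma>)
  then have "\<sigma> permutes UNIV"
    using finite_UNIV_inj_surj[of \<sigma>] by (intro bij_imp_permutes) (auto simp: bij_def)
  moreover have "x = perm_vec \<sigma> y"
    by (simp add: vec_eq_iff \<sigma>)
  ultimately show "x \<in> (\<lambda>\<sigma>. perm_vec \<sigma> y) ` perms" by blast
next
  assume "x \<in> (\<lambda>\<sigma>. perm_vec \<sigma> y) ` perms"
  then obtain \<sigma> where \<sigma>: "\<sigma> permutes UNIV" "x = perm_vec \<sigma> y" by auto
  have "range (\<lambda>j. x $ j) = (\<lambda>j. y $ j) ` range \<sigma>"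
    by (auto simp: \<sigma>(2))
  then show "range (\<lambda>j. x $ j) = range (\<lambda>j. y $ j)"
    using permutes_surj[OF \<sigma>(1)] by simp
qed

locale chaos_process = prob_space M for M :: "'a measure" +
  fixes \<epsilon> :: "int \<Rightarrow> 'a \<Rightarrow> real" and a :: "int ^ 'k::finite \<Rightarrow> real" and X :: "int \<Rightarrow> 'a \<Rightarrow> real"
  assumes iid: "iid_standardized M \<epsilon>" and chaos: "causal_discrete_chaos M \<epsilon> a X"
begin

definition noise_prod :: "int \<Rightarrow> int ^ 'k \<Rightarrow> 'a \<Rightarrow> real" where
  "noise_prod n i \<omega> = (\<Prod>j\<in>UNIV. \<epsilon> (n - i $ j) \<omega>)"

lemma measurable_noise [measurable]: "\<epsilon> i \<in> borel_measurable M"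
  using iid by (auto simp: iid_standardized_def indep_vars_def)

lemma measurable_noise_prod [measurable]: "noise_prod n i \<in> borel_measurable M"
  unfolding noise_prod_def by measurable

lemma noise_prod_eq:
  assumes "inj (\<lambda>j. i $ j)"
  shows "noise_prod n i \<omega> = (\<Prod>t\<in>range (\<lambda>j. n - i $ j). \<epsilon> t \<omega>)"
  using assms by (subst prod.reindex) (auto simp: noise_prod_def inj_def)

lemma expectation_noise_prod_mult:
  assumes "inj (\<lambda>j. i $ j)" "inj (\<lambda>j. i' $ j)"
  shows "integrable M (\<lambda>\<omega>. noise_prod p i \<omega> * noise_prod q i' \<omega>)"
    and "expectation (\<lambda>\<omega>. noise_prod p i \<omega> * noise_prod q i' \<omega>)
      = (if i \<in> (\<lambda>\<sigma>. perm_vec \<sigma> (shift_vec (p - q) i')) ` perms then 1 else 0)"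
proof -
  let ?P = "range (\<lambda>j. p - i $ j)" and ?Q = "range (\<lambda>j. q - i' $ j)"
  have "?P = ?Q \<longleftrightarrow> (\<lambda>t. p - t) ` ?P = (\<lambda>t. p - t) ` ?Q"
    by (rule inj_image_eq_iff[symmetric]) (simp add: inj_def)
  also have "\<dots> \<longleftrightarrow> range (\<lambda>j. i $ j) = range (\<lambda>j. shift_vec (p - q) i' $ j)"
    by (simp add: image_image algebra_simps)
  also have "\<dots> \<longleftrightarrow> i \<in> (\<lambda>\<sigma>. perm_vec \<sigma> (shift_vec (p - q) i')) ` perms"
    using assms by (intro range_eq_iff_perm_vec) (auto simp: inj_def)
  finally have *: "?P = ?Q \<longleftrightarrow> i \<in> (\<lambda>\<sigma>. perm_vec \<sigma> (shift_vec (p - q) i')) ` perms" .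
  show "integrable M (\<lambda>\<omega>. noise_prod p i \<omega> * noise_prod q i' \<omega>)"
    using expectation_prod_mult_prod(1)[OF iid, of ?P ?Q] by (simp add: noise_prod_eq assms)
  show "expectation (\<lambda>\<omega>. noise_prod p i \<omega> * noise_prod q i' \<omega>)
      = (if i \<in> (\<lambda>\<sigma>. perm_vec \<sigma> (shift_vec (p - q) i')) ` perms then 1 else 0)"
    using expectation_prod_mult_prod(2)[OF iid, of ?P ?Q] by (simp add: noise_prod_eq assms *)
qed

lemma noise_prod_square_integrable:
  assumes "inj (\<lambda>j. i $ j)"
  shows "integrable M (\<lambda>\<omega>. (noise_prod p i \<omega>)\<^sup>2)"
  using expectation_noise_prod_mult(1)[OF assms assms, of p p] by (simp add: power2_eq_square)

lemma expectation_noise_prod: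
  assumes "inj (\<lambda>j. i $ j)"
  shows "expectation (noise_prod p i) = 0"
  using expectation_prod_mult_prod(2)[OF iid, of "range (\<lambda>j. p - i $ j)" "{}"]
  by (simp add: noise_prod_eq[OF assms, abs_def])

lemma X_measurable [measurable]: "X n \<in> borel_measurable M"
  and X_square_integrable: "integrable M (\<lambda>\<omega>. (X n \<omega>)\<^sup>2)"
  and X_lim: "((\<lambda>F. expectation (\<lambda>\<omega>. (X n \<omega> - (\<Sum>i\<in>F. a i * noise_prod n i \<omega>))\<^sup>2)) \<longlongrightarrow> 0)
      (finite_subsets_at_top offdiag_lattice)"
  using chaos by (auto simp: causal_discrete_chaos_def noise_prod_def)

lemma X_integrable: "integrable M (X n)"
  using integrable_mult_of_square_integrable[of "X n" M "\<lambda>_. 1"] X_square_integrable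
  by simp

lemma partial_sum_square_integrable:
  assumes "finite F" "F \<subseteq> offdiag_lattice"
  shows "integrable M (\<lambda>\<omega>. (\<Sum>i\<in>F. a i * noise_prod n i \<omega>)\<^sup>2)"
proof -
  have "integrable M (\<lambda>\<omega>. a i * noise_prod n i \<omega> * (a i' * noise_prod n i' \<omega>))" if "i \<in> F" "i' \<in> F" for i i'
  proof -
    have "integrable M (\<lambda>\<omega>. noise_prod n i \<omega> * noise_prod n i' \<omega>)"
      using that assms by (intro expectation_noise_prod_mult) (auto simp: offdiag_lattice_iff)
    from integrable_mult_right[OF this, of "a i * a i'"] show ?thesis
      by (simp add: algebra_simps)
  qed
  then show ?thesis
    by (auto simp: power2_eq_square sum_product intro!: Bochner_Integration.integrable_sum)
qed

lemma expectation_mult_X_lim: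
  assumes [measurable]: "Z \<in> borel_measurable M" and sq: "integrable M (\<lambda>\<omega>. (Z \<omega>)\<^sup>2)"
  shows "((\<lambda>F. \<Sum>i\<in>F. a i * expectation (\<lambda>\<omega>. Z \<omega> * noise_prod n i \<omega>))
      \<longlongrightarrow> expectation (\<lambda>\<omega>. Z \<omega> * X n \<omega>)) (finite_subsets_at_top offdiag_lattice)"
proof -
  let ?A = "finite_subsets_at_top (offdiag_lattice :: (int ^ 'k) set)"
  (* The partial sums are square integrable only over sets of multi-indices without repetitions,
     so they are replaced by 0 over all other finite sets, which do not occur along the net. *)
  define S where "S F \<omega> = (if finite F \<and> F \<subseteq> offdiag_lattice then \<Sum>i\<in>F. a i * noise_prod n i \<omega> else 0)"
    for F \<omega>
  have fin: "\<forall>\<^sub>F F in ?A. finite F \<and> F \<subseteq> offdiag_lattice"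
    by (auto simp: eventually_finite_subsets_at_top)
  have [measurable]: "S F \<in> borel_measurable M" for F
    unfolding S_def by measurable
  have S_sq: "integrable M (\<lambda>\<omega>. (S F \<omega>)\<^sup>2)" for F
  proof (cases "finite F \<and> F \<subseteq> (offdiag_lattice :: (int ^ 'k) set)")
    case True
    then show ?thesis
      using partial_sum_square_integrable[of F n] by (simp add: S_def)
  next
    case False
    have "(\<lambda>\<omega>. (S F \<omega>)\<^sup>2) = (\<lambda>\<omega>. 0)"
      unfolding S_def if_not_P[OF False] by simp
    then show ?thesis by simp
  qed
  have "((\<lambda>F. expectation (\<lambda>\<omega>. (X n \<omega> - S F \<omega>)\<^sup>2)) \<longlongrightarrow> 0) ?A"
    by (rule Lim_transform_eventually[OF X_lim[of n]])
       (use fin in eventually_elim, simp add: S_def)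
  then have "((\<lambda>F. expectation (\<lambda>\<omega>. Z \<omega> * S F \<omega>)) \<longlongrightarrow> expectation (\<lambda>\<omega>. Z \<omega> * X n \<omega>)) ?A"
    by (intro tendsto_integral_mult_of_L2 X_square_integrable sq S_sq) measurable
  moreover have "\<forall>\<^sub>F F in ?A. expectation (\<lambda>\<omega>. Z \<omega> * S F \<omega>)
      = (\<Sum>i\<in>F. a i * expectation (\<lambda>\<omega>. Z \<omega> * noise_prod n i \<omega>))"
    using fin
  proof eventually_elim
    case (elim F)
    have "integrable M (\<lambda>\<omega>. Z \<omega> * noise_prod n i \<omega>)" if "i \<in> F" for i
      using that elim sq by (intro integrable_mult_of_square_integrable noise_prod_square_integrable)
        (auto simp: offdiag_lattice_iff)
    then have "(\<Sum>i\<in>F. a i * expectation (\<lambda>\<omega>. Z \<omega> * noise_prod n i \<omega>))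
        = expectation (\<lambda>\<omega>. \<Sum>i\<in>F. a i * (Z \<omega> * noise_prod n i \<omega>))"
      by (subst Bochner_Integration.integral_sum) auto
    also have "\<dots> = expectation (\<lambda>\<omega>. Z \<omega> * S F \<omega>)"
      using elim by (simp add: S_def sum_distrib_left algebra_simps)
    finally show ?case by simp
  qed
  ultimately show ?thesis
    by (rule Lim_transform_eventually)
qed

lemma expectation_X: "expectation (X n) = 0"
proof -
  have "((\<lambda>F. \<Sum>i\<in>F. a i * expectation (noise_prod n i)) \<longlongrightarrow> expectation (X n))
      (finite_subsets_at_top offdiag_lattice)"
    using expectation_mult_X_lim[of "\<lambda>_. 1" n] by simp
  moreover have "\<forall>\<^sub>F F in finite_subsets_at_top offdiag_lattice.
      (\<Sum>i\<in>F. a i * expectation (noise_prod n i)) = 0"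
    by (auto simp: eventually_finite_subsets_at_top offdiag_lattice_iff expectation_noise_prod subset_iff
        intro!: exI[of _ "{}"] sum.neutral)
  ultimately have "((\<lambda>F. 0) \<longlongrightarrow> expectation (X n)) (finite_subsets_at_top (offdiag_lattice :: (int ^ 'k) set))"
    by (rule Lim_transform_eventually)
  then show ?thesis
    by (simp add: tendsto_const_iff)
qed

text \<open>Only the finitely many rearrangements of \<open>i' + n\<close> correlate with the given noise product, so
  the correlations with the partial sums of \<open>X\<close> are eventually constant along the net of finite
  index sets.\<close>
lemma expectation_noise_prod_mult_X:
  assumes "0 \<le> n" "i' \<in> offdiag_lattice"
  shows "expectation (\<lambda>\<omega>. noise_prod m i' \<omega> * X (m + n) \<omega>) = (\<Sum>\<sigma>\<in>perms. a (perm_vec \<sigma> (shift_vec n i')))"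
proof -
  let ?A = "finite_subsets_at_top (offdiag_lattice :: (int ^ 'k) set)"
  define G where "G = (\<lambda>\<sigma>. perm_vec \<sigma> (shift_vec n i')) ` perms"
  have shift: "shift_vec n i' \<in> offdiag_lattice"
    using assms by (rule shift_vec_offdiag)
  have G: "finite G" "G \<subseteq> offdiag_lattice"
    using shift by (auto simp: G_def perm_vec_offdiag)
  have "((\<lambda>F. \<Sum>i\<in>F. a i * expectation (\<lambda>\<omega>. noise_prod m i' \<omega> * noise_prod (m + n) i \<omega>))
      \<longlongrightarrow> expectation (\<lambda>\<omega>. noise_prod m i' \<omega> * X (m + n) \<omega>)) ?A"
    using assms by (intro expectation_mult_X_lim noise_prod_square_integrable) (auto simp: offdiag_lattice_iff)
  moreover have "\<forall>\<^sub>F F in ?A. (\<Sum>i\<in>F. a i * expectation (\<lambda>\<omega>. noise_prod m i' \<omega> * noise_prod (m + n) i \<omega>))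
      = (\<Sum>i\<in>G. a i)"
  proof -
    have "(\<Sum>i\<in>F. a i * expectation (\<lambda>\<omega>. noise_prod m i' \<omega> * noise_prod (m + n) i \<omega>)) = (\<Sum>i\<in>G. a i)"
      if F: "finite F" "G \<subseteq> F" "F \<subseteq> offdiag_lattice" for F
    proof -
      have "(\<Sum>i\<in>F. a i * expectation (\<lambda>\<omega>. noise_prod m i' \<omega> * noise_prod (m + n) i \<omega>))
          = (\<Sum>i\<in>F. if i \<in> G then a i else 0)"
      proof (rule sum.cong[OF refl])
        fix i assume "i \<in> F"
        then have "expectation (\<lambda>\<omega>. noise_prod (m + n) i \<omega> * noise_prod m i' \<omega>) = (if i \<in> G then 1 else 0)"
          using F assms by (subst expectation_noise_prod_mult(2)) (auto simp: offdiag_lattice_iff G_def)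
        then show "a i * expectation (\<lambda>\<omega>. noise_prod m i' \<omega> * noise_prod (m + n) i \<omega>) = (if i \<in> G then a i else 0)"
          by (simp add: mult.commute)
      qed
      also have "\<dots> = (\<Sum>i\<in>G. a i)"
        using F by (subst sum.inter_restrict[symmetric]) (auto simp: Int_absorb1)
      finally show ?thesis .
    qed
    with G show ?thesis
      by (auto simp: eventually_finite_subsets_at_top intro!: exI[of _ G])
  qed
  ultimately have "((\<lambda>F. \<Sum>i\<in>G. a i) \<longlongrightarrow> expectation (\<lambda>\<omega>. noise_prod m i' \<omega> * X (m + n) \<omega>)) ?A"
    by (rule Lim_transform_eventually)
  then have "expectation (\<lambda>\<omega>. noise_prod m i' \<omega> * X (m + n) \<omega>) = (\<Sum>i\<in>G. a i)"
    by (simp add: tendsto_const_iff)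
  also have "\<dots> = (\<Sum>\<sigma>\<in>perms. a (perm_vec \<sigma> (shift_vec n i')))"
    unfolding G_def using shift
    by (subst sum.reindex) (auto simp: offdiag_lattice_iff intro!: inj_on_perm_vec)
  finally show ?thesis .
qed

text \<open>Approximating only one of the two factors by partial sums makes the mean-square limit literally
  an unordered sum over multi-indices, since the correlations of the other factor with the noise
  products are already known exactly.\<close>
lemma expectation_X_mult_X:
  assumes "0 \<le> n"
  shows "((\<lambda>i. a i * (\<Sum>\<sigma>\<in>perms. a (perm_vec \<sigma> (shift_vec n i))))
    has_sum expectation (\<lambda>\<omega>. X (m + n) \<omega> * X m \<omega>)) offdiag_lattice"
  unfolding has_sum_def
proof (rule Lim_transform_eventually)
  show "((\<lambda>F. \<Sum>i\<in>F. a i * expectation (\<lambda>\<omega>. X (m + n) \<omega> * noise_prod m i \<omega>))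
    \<longlongrightarrow> expectation (\<lambda>\<omega>. X (m + n) \<omega> * X m \<omega>)) (finite_subsets_at_top offdiag_lattice)"
    by (intro expectation_mult_X_lim X_square_integrable) auto
  have "(\<Sum>i\<in>F. a i * expectation (\<lambda>\<omega>. X (m + n) \<omega> * noise_prod m i \<omega>))
      = (\<Sum>i\<in>F. a i * (\<Sum>\<sigma>\<in>perms. a (perm_vec \<sigma> (shift_vec n i))))" if "F \<subseteq> offdiag_lattice" for F
    using that assms
    by (intro sum.cong refl) (auto simp: mult.commute[of "X _ _"] expectation_noise_prod_mult_X)
  then show "\<forall>\<^sub>F F in finite_subsets_at_top offdiag_lattice.
      (\<Sum>i\<in>F. a i * expectation (\<lambda>\<omega>. X (m + n) \<omega> * noise_prod m i \<omega>))
      = (\<Sum>i\<in>F. a i * (\<Sum>\<sigma>\<in>perms. a (perm_vec \<sigma> (shift_vec n i))))"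
    by (auto simp: eventually_finite_subsets_at_top)
qed

end

section \<open>Lattice sums as integrals\<close>

lemma Basis_vec_eq: "(Basis :: (real ^ 'k::finite) set) = range (\<lambda>j. axis j 1)"
  by (auto simp: Basis_vec_def)

lemma nn_integral_lborel_prod_vec:
  fixes f :: "'k::finite \<Rightarrow> real \<Rightarrow> ennreal"
  assumes [measurable]: "\<And>j. f j \<in> borel_measurable borel"
  shows "(\<integral>\<^sup>+x. (\<Prod>j\<in>UNIV. f j (x $ j)) \<partial>(lborel :: (real ^ 'k) measure)) = (\<Prod>j\<in>UNIV. \<integral>\<^sup>+t. f j t \<partial>lborel)"
proof -
  define h :: "real ^ 'k \<Rightarrow> 'k" where "h = inv (\<lambda>j. axis j 1)"
  have inj: "inj (\<lambda>j::'k. axis j (1::real))"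
    by (simp add: inj_def axis_eq_axis)
  have h: "h (axis j 1) = j" for j
    unfolding h_def by (rule inv_f_f[OF inj])
  have reindex: "(\<Prod>b\<in>Basis. F b) = (\<Prod>j\<in>UNIV. F (axis j 1))" for F :: "real ^ 'k \<Rightarrow> ennreal"
    unfolding Basis_vec_eq by (subst prod.reindex[OF inj]) simp
  have "(\<integral>\<^sup>+x. (\<Prod>b\<in>Basis. f (h b) (x \<bullet> b)) \<partial>(lborel :: (real ^ 'k) measure))
      = (\<Prod>b\<in>Basis. \<integral>\<^sup>+t. f (h b) t \<partial>lborel)"
    by (rule nn_integral_lborel_prod) auto
  then show ?thesis
    by (simp add: reindex h cart_eq_inner_axis)
qed

lemma borel_measurable_vec_nth [measurable]: "(\<lambda>x::real ^ 'k::finite. x $ j) \<in> borel_measurable borel"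
  by (intro borel_measurable_continuous_onI continuous_intros)

lemma emeasure_lborel_prod_vec:
  fixes A :: "'k::finite \<Rightarrow> real set"
  assumes [measurable]: "\<And>j. A j \<in> sets borel"
  shows "emeasure lborel {x :: real ^ 'k. \<forall>j. x $ j \<in> A j} = (\<Prod>j\<in>UNIV. emeasure lborel (A j))"
proof -
  have "emeasure lborel {x :: real ^ 'k. \<forall>j. x $ j \<in> A j}
      = (\<integral>\<^sup>+x. indicator {x :: real ^ 'k. \<forall>j. x $ j \<in> A j} x \<partial>lborel)"
    by (subst nn_integral_indicator) measurable
  also have "\<dots> = (\<integral>\<^sup>+x. (\<Prod>j\<in>UNIV. indicator (A j) (x $ j)) \<partial>(lborel :: (real ^ 'k) measure))"
    by (intro nn_integral_cong) (auto simp: indicator_def prod_zero_iff)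
  also have "\<dots> = (\<Prod>j\<in>UNIV. emeasure lborel (A j))"
    by (subst nn_integral_lborel_prod_vec) auto
  finally show ?thesis .
qed

text \<open>The upper corner of the grid cell of mesh \<open>1/n\<close> that contains \<open>x\<close>, in units of the mesh. The
  upper corner is used, not the lower one, so that positive \<open>x\<close> go to positive multi-indices and
  functions decreasing in every coordinate are larger at \<open>x\<close> than at the corner.\<close>
definition cell :: "nat \<Rightarrow> real ^ 'k \<Rightarrow> int ^ 'k::finite" where
  "cell n x = (\<chi> j. \<lfloor>real n * x $ j\<rfloor> + 1)"

lemma cell_nth [simp]: "cell n x $ j = \<lfloor>real n * x $ j\<rfloor> + 1"
  by (simp add: cell_def)

lemma cell_vimage:
  assumes "n > 0"
  shows "cell n -` {i} = {x. \<forall>j. x $ j \<in> {(of_int (i $ j) - 1) / real n ..< of_int (i $ j) / real n}}"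
proof -
  have *: "\<lfloor>real n * t\<rfloor> + 1 = m \<longleftrightarrow> t \<in> {(of_int m - 1) / real n ..< of_int m / real n}" for t m
  proof -
    have "\<lfloor>real n * t\<rfloor> + 1 = m \<longleftrightarrow> \<lfloor>real n * t\<rfloor> = m - 1" by auto
    also have "\<dots> \<longleftrightarrow> of_int (m - 1) \<le> real n * t \<and> real n * t < of_int (m - 1) + 1"
      by (rule floor_eq_iff)
    also have "\<dots> \<longleftrightarrow> t \<in> {(of_int m - 1) / real n ..< of_int m / real n}"
      using assms by (simp add: field_simps)
    finally show ?thesis .
  qed
  have "x \<in> cell n -` {i} \<longleftrightarrow> (\<forall>j. \<lfloor>real n * x $ j\<rfloor> + 1 = i $ j)" for x
    by (simp add: vec_eq_iff)
  then show ?thesis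
    by (simp only: set_eq_iff mem_Collect_eq * simp_thms)
qed

lemma measurable_cell [measurable]:
  assumes "n > 0"
  shows "cell n \<in> borel \<rightarrow>\<^sub>M count_space UNIV"
proof -
  have "cell n -` {i} \<in> sets borel" for i :: "int ^ 'k"
    unfolding cell_vimage[OF assms] by measurable
  then show ?thesis
    by (subst measurable_count_space_eq_countable) auto
qed

text \<open>Every grid cell has volume \<open>n\<^bsup>-k\<^esup>\<close>, so scaled Lebesgue measure is mapped to counting measure.
  Sums over the lattice thereby become integrals, to which dominated convergence applies.\<close>
lemma distr_cell:
  assumes "n > 0"
  shows "distr (density (lborel :: (real ^ 'k::finite) measure) (\<lambda>_. ennreal (real n ^ CARD('k))))
      (count_space UNIV) (cell n) = count_space UNIV"
proof (rule measure_eqI_countable[of _ UNIV])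
  fix i :: "int ^ 'k"
  have [measurable]: "cell n \<in> borel \<rightarrow>\<^sub>M count_space (UNIV :: (int ^ 'k) set)"
    by (rule measurable_cell[OF assms])
  have "cell n -` {i} \<in> sets borel"
    unfolding cell_vimage[OF assms] by measurable
  then have "emeasure (distr (density (lborel :: (real ^ 'k) measure) (\<lambda>_. ennreal (real n ^ CARD('k))))
      (count_space UNIV) (cell n)) {i} = ennreal (real n ^ CARD('k)) * emeasure lborel (cell n -` {i})"
    by (subst emeasure_distr) (auto simp: emeasure_density nn_integral_cmult_indicator)
  also have "emeasure lborel (cell n -` {i}) = (\<Prod>j\<in>(UNIV :: 'k set). ennreal (1 / real n))"
    unfolding cell_vimage[OF assms] using assms
    by (subst emeasure_lborel_prod_vec) (auto intro!: prod.cong arg_cong[of _ _ ennreal]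
        simp: divide_right_mono diff_divide_distrib)
  also have "ennreal (real n ^ CARD('k)) * \<dots> = 1"
    using assms by (simp add: ennreal_power ennreal_mult[symmetric] power_divide)
  finally show "emeasure (distr (density (lborel :: (real ^ 'k) measure) (\<lambda>_. ennreal (real n ^ CARD('k))))
      (count_space UNIV) (cell n)) {i} = emeasure (count_space UNIV) {i}"
    by simp
qed auto

lemma has_sum_lattice_integral:
  fixes \<phi> :: "int ^ 'k::finite \<Rightarrow> real"
  assumes "n > 0" and int: "integrable lborel (\<lambda>x. \<phi> (cell n x))"
  shows "(\<phi> has_sum (real n ^ CARD('k) * (\<integral>x. \<phi> (cell n x) \<partial>lborel))) UNIV"
    and "(\<lambda>i. \<bar>\<phi> i\<bar>) summable_on UNIV"
proof -
  define D where "D = density (lborel :: (real ^ 'k) measure) (\<lambda>_. ennreal (real n ^ CARD('k)))"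
  have [measurable]: "cell n \<in> borel \<rightarrow>\<^sub>M count_space (UNIV :: (int ^ 'k) set)"
    by (rule measurable_cell[OF assms(1)])
  have distr: "distr D (count_space UNIV) (cell n) = count_space UNIV"
    unfolding D_def by (rule distr_cell[OF assms(1)])
  have [measurable_cong]: "sets D = sets borel" by (simp add: D_def)
  have "integrable D (\<lambda>x. \<phi> (cell n x))"
    using int unfolding D_def by (subst integrable_density) auto
  then have "integrable (distr D (count_space UNIV) (cell n)) \<phi>"
    by (subst integrable_distr_eq) auto
  then have abs: "Infinite_Set_Sum.abs_summable_on \<phi> UNIV"
    by (simp add: distr Infinite_Set_Sum.abs_summable_on_def)
  then have abs': "(\<lambda>i. norm (\<phi> i)) summable_on UNIV"
    using abs_summable_equivalent[of \<phi> UNIV] by blast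
  then show "(\<lambda>i. \<bar>\<phi> i\<bar>) summable_on UNIV" by simp
  have "infsum \<phi> UNIV = infsetsum \<phi> UNIV"
    by (rule infsetsum_infsum[OF abs, symmetric])
  also have "\<dots> = integral\<^sup>L (distr D (count_space UNIV) (cell n)) \<phi>"
    by (simp add: distr infsetsum_def)
  also have "\<dots> = (\<integral>x. \<phi> (cell n x) \<partial>D)"
    by (rule integral_distr) auto
  also have "\<dots> = (\<integral>x. real n ^ CARD('k) *\<^sub>R \<phi> (cell n x) \<partial>lborel)"
    unfolding D_def by (rule integral_density) auto
  finally have "infsum \<phi> UNIV = real n ^ CARD('k) * (\<integral>x. \<phi> (cell n x) \<partial>lborel)"
    by simp
  moreover have "(\<phi> has_sum infsum \<phi> UNIV) UNIV"
    using abs' abs_summable_summable by (intro has_sum_infsum) blast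
  ultimately show "(\<phi> has_sum (real n ^ CARD('k) * (\<integral>x. \<phi> (cell n x) \<partial>lborel))) UNIV"
    by simp
qed

section \<open>Sums of power products\<close>

text \<open>The exponents of the majorant. Closure under permutations of the coordinates makes
  the majorant symmetric, so that it also bounds the symmetrized coefficients.\<close>
definition exponents :: "real \<Rightarrow> ('k::finite \<Rightarrow> real) set \<Rightarrow> bool" where
  "exponents \<alpha> \<Delta> \<longleftrightarrow> finite \<Delta> \<and>
     (\<forall>\<delta>\<in>\<Delta>. (\<forall>j. \<delta> j \<in> {-1<..<-1/2}) \<and> (\<Sum>j\<in>UNIV. \<delta> j) = \<alpha> \<and> (\<forall>\<sigma>\<in>perms. \<delta> \<circ> \<sigma> \<in> \<Delta>))"

definition power_sum :: "('k::finite \<Rightarrow> real) set \<Rightarrow> real ^ 'k \<Rightarrow> real" where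
  "power_sum \<Delta> x = (\<Sum>\<delta>\<in>\<Delta>. \<Prod>j\<in>UNIV. x $ j powr \<delta> j)"

lemma power_sum_nonneg: "power_sum \<Delta> x \<ge> 0"
  unfolding power_sum_def by (intro sum_nonneg prod_nonneg) auto

lemma power_sum_antimono:
  assumes "exponents \<alpha> \<Delta>" "\<And>j. 0 < x $ j" "\<And>j. x $ j \<le> y $ j"
  shows "power_sum \<Delta> y \<le> power_sum \<Delta> x"
  unfolding power_sum_def
proof (intro sum_mono prod_mono conjI)
  fix \<delta> j assume "\<delta> \<in> \<Delta>"
  then have "\<delta> j < 0" using assms(1) unfolding exponents_def by (metis greaterThanLessThan_iff less_trans divide_neg_pos neg_less_0_iff_less zero_less_one zero_less_numeral)
  then show "y $ j powr \<delta> j \<le> x $ j powr \<delta> j"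
    using assms(2)[of j] assms(3)[of j] by (intro powr_mono2') auto
qed auto

lemma power_sum_scale:
  assumes "exponents \<alpha> \<Delta>" "0 < c" "\<And>j. 0 < x $ j"
  shows "power_sum \<Delta> (c *\<^sub>R x) = c powr \<alpha> * power_sum \<Delta> x"
proof -
  have "(\<Prod>j\<in>UNIV. (c *\<^sub>R x) $ j powr \<delta> j) = c powr \<alpha> * (\<Prod>j\<in>UNIV. x $ j powr \<delta> j)"
    if "\<delta> \<in> \<Delta>" for \<delta>
  proof -
    have "(\<Prod>j\<in>UNIV. (c *\<^sub>R x) $ j powr \<delta> j) = (\<Prod>j\<in>UNIV. c powr \<delta> j * x $ j powr \<delta> j)"
      using assms by (intro prod.cong) (auto simp: powr_mult less_imp_le)
    also have "\<dots> = (\<Prod>j\<in>UNIV. c powr \<delta> j) * (\<Prod>j\<in>UNIV. x $ j powr \<delta> j)"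
      by (rule prod.distrib)
    also have "(\<Prod>j\<in>UNIV. c powr \<delta> j) = c powr (\<Sum>j\<in>UNIV. \<delta> j)"
      using assms by (simp add: powr_sum)
    also have "(\<Sum>j\<in>UNIV. \<delta> j) = \<alpha>"
      using that assms by (auto simp: exponents_def)
    finally show ?thesis .
  qed
  then show ?thesis
    by (simp add: power_sum_def sum_distrib_left)
qed

lemma power_sum_perm_vec:
  assumes "exponents \<alpha> \<Delta>" and \<sigma>: "\<sigma> permutes UNIV"
  shows "power_sum \<Delta> (perm_vec \<sigma> x) = power_sum \<Delta> x"
proof -
  have inv: "inv \<sigma> permutes UNIV" by (rule permutes_inv[OF \<sigma>])
  have "(\<Prod>j\<in>UNIV. perm_vec \<sigma> x $ j powr \<delta> j) = (\<Prod>j\<in>UNIV. x $ j powr (\<delta> \<circ> inv \<sigma>) j)" for \<delta>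
    using prod.permute[OF \<sigma>, of "\<lambda>j. x $ j powr (\<delta> \<circ> inv \<sigma>) j"] permutes_inverses[OF \<sigma>]
    by (simp add: o_def)
  then have "power_sum \<Delta> (perm_vec \<sigma> x) = (\<Sum>\<delta>\<in>\<Delta>. \<Prod>j\<in>UNIV. x $ j powr (\<delta> \<circ> inv \<sigma>) j)"
    by (simp add: power_sum_def)
  also have "\<dots> = power_sum \<Delta> x"
    unfolding power_sum_def
  proof (rule sum.reindex_bij_witness[of _ "\<lambda>\<delta>. \<delta> \<circ> \<sigma>" "\<lambda>\<delta>. \<delta> \<circ> inv \<sigma>"])
    show "\<delta> \<circ> inv \<sigma> \<circ> \<sigma> = \<delta>" "\<delta> \<circ> \<sigma> \<circ> inv \<sigma> = \<delta>" for \<delta>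
      using permutes_inv_o[OF \<sigma>] by (simp_all add: o_assoc[symmetric])
  qed (use assms inv in \<open>auto simp: exponents_def\<close>)
  finally show ?thesis .
qed

lemma measurable_power_sum [measurable]:
  "(\<lambda>x. power_sum \<Delta> (f x)) \<in> borel_measurable M" if [measurable]: "f \<in> M \<rightarrow>\<^sub>M borel"
  unfolding power_sum_def by measurable

text \<open>Near 0 the integrand is of order \<open>t\<^sup>\<gamma>\<close> with \<open>\<gamma> > -1\<close>; at infinity it is of order \<open>t\<^bsup>\<gamma>+\<gamma>'\<^esup>\<close> with
  \<open>\<gamma> + \<gamma>' < -1\<close>.\<close>
lemma nn_integral_power_product_finite:
  fixes \<gamma> \<gamma>' :: real
  assumes "\<gamma> \<in> {-1<..<-1/2}" "\<gamma>' \<in> {-1<..<-1/2}"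
  shows "(\<integral>\<^sup>+t. ennreal (indicator {0<..} t * (t powr \<gamma> * (1 + t) powr \<gamma>')) \<partial>lborel) < \<infinity>"
proof -
  have "(\<integral>\<^sup>+t. ennreal (indicator {0<..} t * (t powr \<gamma> * (1 + t) powr \<gamma>')) \<partial>lborel)
      \<le> (\<integral>\<^sup>+t. ennreal (indicator {0..1} t * t powr \<gamma>) + ennreal (indicator {1..} t * t powr (\<gamma> + \<gamma>')) \<partial>lborel)"
  proof (rule nn_integral_mono)
    fix t :: real
    have "indicator {0<..} t * (t powr \<gamma> * (1 + t) powr \<gamma>')
        \<le> indicator {0..1} t * t powr \<gamma> + indicator {1..} t * t powr (\<gamma> + \<gamma>')"
    proof (cases "0 < t")
      case True
      show ?thesis
      proof (cases "t \<le> 1")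
        case le: True
        have "(1 + t) powr \<gamma>' \<le> 1 powr \<gamma>'"
          using True assms by (intro powr_mono2') auto
        then have "t powr \<gamma> * (1 + t) powr \<gamma>' \<le> t powr \<gamma> * 1"
          by (intro mult_left_mono) auto
        then show ?thesis using True le by (auto simp: indicator_def)
      next
        case False
        have "(1 + t) powr \<gamma>' \<le> t powr \<gamma>'"
          using True assms by (intro powr_mono2') auto
        then have "t powr \<gamma> * (1 + t) powr \<gamma>' \<le> t powr (\<gamma> + \<gamma>')"
          by (simp add: powr_add mult_left_mono)
        then show ?thesis using True False by (auto simp: indicator_def)
      qed
    qed (auto simp: indicator_def)
    then show "ennreal (indicator {0<..} t * (t powr \<gamma> * (1 + t) powr \<gamma>'))
        \<le> ennreal (indicator {0..1} t * t powr \<gamma>) + ennreal (indicator {1..} t * t powr (\<gamma> + \<gamma>'))"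
      by (simp add: ennreal_leI ennreal_plus[symmetric] del: ennreal_plus)
  qed
  also have "\<dots> = (\<integral>\<^sup>+t. ennreal (indicator {0..1} t * t powr \<gamma>) \<partial>lborel)
      + (\<integral>\<^sup>+t. ennreal (indicator {1..} t * t powr (\<gamma> + \<gamma>')) \<partial>lborel)"
    by (rule nn_integral_add) auto
  also have "(\<integral>\<^sup>+t. ennreal (indicator {0..1} t * t powr \<gamma>) \<partial>lborel) = ennreal (1 powr (\<gamma> + 1) / (\<gamma> + 1))"
    using assms by (intro nn_integral_has_integral_lebesgue has_integral_powr_from_0) auto
  also have "(\<integral>\<^sup>+t. ennreal (indicator {1..} t * t powr (\<gamma> + \<gamma>')) \<partial>lborel)
      = ennreal (-(1 powr (\<gamma> + \<gamma>' + 1)) / (\<gamma> + \<gamma>' + 1))"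
    using assms by (intro nn_integral_has_integral_lebesgue has_integral_powr_to_inf) auto
  finally show ?thesis
    by (rule le_less_trans) simp
qed

lemma pos_orthant_borel [measurable]: "pos_orthant \<in> sets borel"
proof -
  have "pos_orthant = {x :: real ^ 'k. \<forall>j. x $ j \<in> {0<..}}"
    by (auto simp: pos_orthant_def)
  also have "\<dots> \<in> sets borel" by measurable
  finally show ?thesis .
qed

lemma integrable_power_sum_mult:
  fixes \<Delta> :: "('k::finite \<Rightarrow> real) set"
  assumes "exponents \<alpha> \<Delta>"
  shows "integrable lborel (\<lambda>x. indicator pos_orthant x * (power_sum \<Delta> x * power_sum \<Delta> (1 + x)))"
proof -
  have one: "integrable lborel (\<lambda>x. indicator pos_orthant x *
      ((\<Prod>j\<in>UNIV. x $ j powr \<delta> j) * (\<Prod>j\<in>UNIV. (1 + x) $ j powr \<delta>' j)))"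
    if \<delta>: "\<delta> \<in> \<Delta>" "\<delta>' \<in> \<Delta>" for \<delta> \<delta>' :: "'k \<Rightarrow> real"
  proof (rule integrableI_nonneg)
    have "(\<integral>\<^sup>+x. ennreal (indicator pos_orthant x *
        ((\<Prod>j\<in>UNIV. x $ j powr \<delta> j) * (\<Prod>j\<in>UNIV. (1 + x) $ j powr \<delta>' j))) \<partial>lborel)
      = (\<integral>\<^sup>+x. (\<Prod>j\<in>UNIV. ennreal (indicator {0<..} (x $ j) * (x $ j powr \<delta> j * (1 + x $ j) powr \<delta>' j)))
          \<partial>(lborel :: (real ^ 'k) measure))"
    proof (rule nn_integral_cong)
      fix x :: "real ^ 'k"
      have "indicator pos_orthant x = (\<Prod>j\<in>UNIV. indicator {0<..} (x $ j) :: real)"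
        by (auto simp: indicator_def pos_orthant_def prod_zero_iff)
      then show "ennreal (indicator pos_orthant x *
          ((\<Prod>j\<in>UNIV. x $ j powr \<delta> j) * (\<Prod>j\<in>UNIV. (1 + x) $ j powr \<delta>' j)))
        = (\<Prod>j\<in>UNIV. ennreal (indicator {0<..} (x $ j) * (x $ j powr \<delta> j * (1 + x $ j) powr \<delta>' j)))"
        by (subst prod_ennreal) (auto simp: prod.distrib)
    qed
    also have "\<dots> = (\<Prod>j\<in>UNIV. \<integral>\<^sup>+t. ennreal (indicator {0<..} t * (t powr \<delta> j * (1 + t) powr \<delta>' j)) \<partial>lborel)"
      by (rule nn_integral_lborel_prod_vec) measurable
    also have "\<dots> < \<infinity>"
    proof -
      have "(\<integral>\<^sup>+t. ennreal (indicator {0<..} t * (t powr \<delta> j * (1 + t) powr \<delta>' j)) \<partial>lborel) < \<infinity>" for j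
        using \<delta> assms unfolding exponents_def by (intro nn_integral_power_product_finite) blast+
      then show ?thesis
        by (auto simp: less_top[symmetric] ennreal_prod_eq_top)
    qed
    finally show "(\<integral>\<^sup>+x. ennreal (indicator pos_orthant x *
        ((\<Prod>j\<in>UNIV. x $ j powr \<delta> j) * (\<Prod>j\<in>UNIV. (1 + x) $ j powr \<delta>' j))) \<partial>lborel) < \<infinity>" .
  qed (auto intro!: mult_nonneg_nonneg prod_nonneg)
  have "integrable lborel (\<lambda>x. \<Sum>\<delta>\<in>\<Delta>. \<Sum>\<delta>'\<in>\<Delta>. indicator pos_orthant x *
      ((\<Prod>j\<in>UNIV. x $ j powr \<delta> j) * (\<Prod>j\<in>UNIV. (1 + x) $ j powr \<delta>' j)))"
    by (intro Bochner_Integration.integrable_sum one)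
  moreover have "indicator pos_orthant x * (power_sum \<Delta> x * power_sum \<Delta> (1 + x))
    = (\<Sum>\<delta>\<in>\<Delta>. \<Sum>\<delta>'\<in>\<Delta>. indicator pos_orthant x *
      ((\<Prod>j\<in>UNIV. x $ j powr \<delta> j) * (\<Prod>j\<in>UNIV. (1 + x) $ j powr \<delta>' j)))" for x :: "real ^ 'k"
    unfolding power_sum_def sum_product by (simp add: sum_distrib_left)
  ultimately show ?thesis
    by simp
qed

section \<open>Riemann sums of power-dominated coefficients\<close>

lemma AE_lebesgue_translation:
  fixes c :: "'a::euclidean_space"
  assumes "AE x in lebesgue. P x"
  shows "AE x in lebesgue. P (c + x)"
proof -
  obtain N where N: "negligible N" "{x. \<not> P x} \<subseteq> N"
    using assms unfolding eventually_ae_filter_negligible by blast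
  have "{x. \<not> P (c + x)} \<subseteq> (+) (- c) ` N"
    using N(2) by (force simp: image_iff)
  then show ?thesis
    unfolding eventually_ae_filter_negligible using negligible_translation[OF N(1)] by blast
qed

lemma AE_lebesgue_perm_vec:
  fixes P :: "real ^ 'k::finite \<Rightarrow> bool"
  assumes "AE x in lebesgue. P x" and \<sigma>: "\<sigma> permutes UNIV"
  shows "AE x in lebesgue. P (perm_vec \<sigma> x)"
proof -
  obtain N where N: "negligible N" "{x. \<not> P x} \<subseteq> N"
    using assms unfolding eventually_ae_filter_negligible by blast
  have lin: "linear (perm_vec (inv \<sigma>) :: real ^ 'k \<Rightarrow> real ^ 'k)"
    by (intro linearI) (simp_all add: vec_eq_iff)
  have inv: "x = perm_vec (inv \<sigma>) (perm_vec \<sigma> x)" for x :: "real ^ 'k"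
    using permutes_inverses[OF \<sigma>] by (simp add: vec_eq_iff)
  have "{x. \<not> P (perm_vec \<sigma> x)} \<subseteq> perm_vec (inv \<sigma>) ` N"
  proof
    fix x assume "x \<in> {x. \<not> P (perm_vec \<sigma> x)}"
    then have "perm_vec \<sigma> x \<in> N" using N(2) by blast
    with inv[of x] show "x \<in> perm_vec (inv \<sigma>) ` N" by (rule image_eqI)
  qed
  moreover have "negligible (perm_vec (inv \<sigma>) ` N)"
    by (rule negligible_differentiable_image_negligible[OF _ N(1) linear_imp_differentiable_on[OF lin]]) simp
  ultimately show ?thesis
    unfolding eventually_ae_filter_negligible by blast
qed

lemma AE_lebesgue_inj_nth:
  "AE x in (lebesgue :: (real ^ 'k::finite) measure). inj (\<lambda>j. x $ j) \<and> (\<forall>j. x $ j \<noteq> 0)"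
proof -
  have "AE x in (lebesgue :: (real ^ 'k) measure). p \<noteq> q \<longrightarrow> x $ p \<noteq> x $ q" for p q
  proof (cases "p = q")
    case False
    have ne: "axis p 1 - axis q 1 \<noteq> (0 :: real ^ 'k)"
      using False by (simp add: axis_eq_axis)
    have "negligible {x. (axis p 1 - axis q 1 :: real ^ 'k) \<bullet> x = 0}"
      using ne by (intro negligible_hyperplane) simp
    moreover have "{x :: real ^ 'k. \<not> (p \<noteq> q \<longrightarrow> x $ p \<noteq> x $ q)} \<subseteq> {x. (axis p 1 - axis q 1) \<bullet> x = 0}"
      by (auto simp: inner_diff_left inner_axis')
    ultimately show ?thesis
      unfolding eventually_ae_filter_negligible by blast
  qed simp
  then have "AE x in (lebesgue :: (real ^ 'k) measure). \<forall>p q. p \<noteq> q \<longrightarrow> x $ p \<noteq> x $ q"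
    by (simp add: AE_all_countable)
  moreover have "AE x in (lebesgue :: (real ^ 'k) measure). x $ j \<noteq> 0" for j
  proof -
    have "negligible {x. (axis j 1 :: real ^ 'k) \<bullet> x = 0}"
      by (intro negligible_hyperplane) (simp add: axis_eq_0_iff)
    moreover have "{x :: real ^ 'k. \<not> x $ j \<noteq> 0} \<subseteq> {x. axis j 1 \<bullet> x = 0}"
      by (auto simp: inner_axis')
    ultimately show ?thesis
      unfolding eventually_ae_filter_negligible by blast
  qed
  then have "AE x in (lebesgue :: (real ^ 'k) measure). \<forall>j. x $ j \<noteq> 0"
    by (simp add: AE_all_countable)
  ultimately show ?thesis
    by eventually_elim (auto simp: inj_def)
qed

text \<open>Lebesgue measure is complete, so the almost everywhere limit is measurable. This gives
  the measurability of \<open>f x * f (1 + x)\<close> for the symmetrized kernel without studying compositions of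
  the kernel with permutations and translations.\<close>
lemma borel_measurable_lebesgue_AE_limit:
  fixes s :: "nat \<Rightarrow> 'a::euclidean_space \<Rightarrow> real"
  assumes [measurable]: "\<And>n. s n \<in> borel_measurable lebesgue"
    and lim: "AE x in lebesgue. (\<lambda>n. s n x) \<longlonglongrightarrow> h x"
  shows "h \<in> borel_measurable lebesgue"
proof (rule measurableI)
  fix B :: "real set" assume [measurable]: "B \<in> sets borel"
  have "(\<lambda>x. lim (\<lambda>n. s n x)) \<in> borel_measurable lebesgue" by measurable
  then have "(\<lambda>x. lim (\<lambda>n. s n x)) -` B \<inter> space lebesgue \<in> sets lebesgue"
    by (rule measurable_sets) simp
  moreover have "AE x in lebesgue. x \<in> (\<lambda>x. lim (\<lambda>n. s n x)) -` B \<inter> space lebesgue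
      \<longleftrightarrow> x \<in> h -` B \<inter> space lebesgue"
    using lim by eventually_elim (auto simp: limI)
  ultimately show "h -` B \<inter> space lebesgue \<in> sets lebesgue"
    using completion.in_sets_AE by blast
qed simp

lemma real_vec_nth [simp]: "real_vec i $ j = of_int (i $ j)"
  by (simp add: real_vec_def)

lemma shift_vec_cell: "shift_vec (int n) (cell n x) = cell n (1 + x)"
proof -
  have "\<lfloor>real n * (1 + x $ j)\<rfloor> = \<lfloor>real n * x $ j\<rfloor> + int n" for j
  proof -
    have "real n * (1 + x $ j) = real n * x $ j + of_int (int n)"
      by (simp add: algebra_simps)
    then show ?thesis by (simp only: floor_add_int)
  qed
  then show ?thesis
    by (simp add: vec_eq_iff)
qed

lemma perm_vec_cell: "perm_vec \<sigma> (cell n x) = cell n (perm_vec \<sigma> x)"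
  by (simp add: vec_eq_iff)

lemma cell_scaled_ge:
  assumes "n > 0"
  shows "x $ j \<le> ((1 / real n) *\<^sub>R real_vec (cell n x)) $ j"
proof -
  have "real n * x $ j \<le> of_int \<lfloor>real n * x $ j\<rfloor> + 1" by linarith
  with assms show ?thesis by (simp add: field_simps)
qed

lemma cell_scaled_tendsto:
  "(\<lambda>n. (1 / real n) *\<^sub>R real_vec (cell n x)) \<longlonglongrightarrow> x"
proof (rule vec_tendstoI)
  fix j
  show "(\<lambda>n. ((1 / real n) *\<^sub>R real_vec (cell n x)) $ j) \<longlonglongrightarrow> x $ j"
  proof (rule tendsto_sandwich)
    show "\<forall>\<^sub>F n in sequentially. x $ j \<le> ((1 / real n) *\<^sub>R real_vec (cell n x)) $ j"
      using eventually_gt_at_top[of 0] by eventually_elim (rule cell_scaled_ge)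
    show "\<forall>\<^sub>F n in sequentially. ((1 / real n) *\<^sub>R real_vec (cell n x)) $ j \<le> x $ j + 1 / real n"
      using eventually_gt_at_top[of 0]
    proof eventually_elim
      case (elim n)
      have "of_int \<lfloor>real n * x $ j\<rfloor> + 1 \<le> real n * x $ j + 1" by linarith
      with elim show ?case by (simp add: field_simps)
    qed
    show "(\<lambda>n. x $ j + 1 / real n) \<longlonglongrightarrow> x $ j"
      using tendsto_add[OF tendsto_const lim_1_over_n] by simp
  qed simp
qed

lemma cell_pos_lattice: "x \<in> pos_orthant \<Longrightarrow> cell n x \<in> pos_lattice"
proof -
  assume x: "x \<in> pos_orthant"
  have "0 < \<lfloor>real n * x $ j\<rfloor> + 1" for j
  proof -
    have "0 \<le> real n * x $ j"
      using x by (simp add: pos_orthant_def less_imp_le)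
    then have "0 \<le> \<lfloor>real n * x $ j\<rfloor>" by simp
    then show ?thesis by simp
  qed
  then show ?thesis by (simp add: pos_lattice_def)
qed

lemma cell_offdiag_eventually:
  assumes "x \<in> pos_orthant" "inj (\<lambda>j. x $ j)"
  shows "\<forall>\<^sub>F n in sequentially. cell n x \<in> offdiag_lattice"
proof -
  have "\<forall>\<^sub>F n in sequentially. p \<noteq> q \<longrightarrow> cell n x $ p \<noteq> cell n x $ q" for p q
  proof (cases "p = q")
    case False
    then have d: "\<bar>x $ p - x $ q\<bar> > 0" using assms(2) by (auto simp: inj_def)
    have "\<forall>\<^sub>F n in sequentially. 1 / \<bar>x $ p - x $ q\<bar> < real n"
      using filterlim_real_sequentially by (auto simp: filterlim_at_top_dense)
    then show ?thesis
    proof eventually_elim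
      case (elim n)
      then have "1 < \<bar>real n\<bar> * \<bar>x $ p - x $ q\<bar>"
        using d by (simp add: field_simps)
      also have "\<dots> = \<bar>real n * x $ p - real n * x $ q\<bar>"
        unfolding right_diff_distrib[symmetric] abs_mult ..
      finally have "1 < \<bar>real n * x $ p - real n * x $ q\<bar>" .
      then have "\<lfloor>real n * x $ p\<rfloor> \<noteq> \<lfloor>real n * x $ q\<rfloor>" by linarith
      then show ?case by simp
    qed
  qed simp
  then have "\<forall>\<^sub>F n in sequentially. \<forall>p q. p \<noteq> q \<longrightarrow> cell n x $ p \<noteq> cell n x $ q"
    by (simp only: eventually_all_finite)
  then show ?thesis
    by eventually_elim (use assms(1) cell_pos_lattice in \<open>auto simp: offdiag_lattice_def\<close>)
qed

text \<open>The bound is required only where the entries are distinct, because the sums omit the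
  diagonals.\<close>
locale power_dominated =
  fixes \<alpha> K :: real and \<Delta> :: "('k::finite \<Rightarrow> real) set" and A :: "int ^ 'k \<Rightarrow> real"
  assumes exps: "exponents \<alpha> \<Delta>" and K_nonneg: "0 \<le> K"
    and dominated: "\<And>i. i \<in> offdiag_lattice \<Longrightarrow> \<bar>A i\<bar> \<le> K * power_sum \<Delta> (real_vec i)"
begin

definition lag_product :: "int \<Rightarrow> int ^ 'k \<Rightarrow> real" where
  "lag_product d i = (if i \<in> offdiag_lattice then A i * A (shift_vec d i) else 0)"

definition R :: "int \<Rightarrow> real" where
  "R d = infsum (\<lambda>i. A i * A (shift_vec d i)) offdiag_lattice"

lemma A_bound:
  assumes "n > 0" "i \<in> offdiag_lattice" "\<And>j. 0 < x $ j" "\<And>j. real n * x $ j \<le> of_int (i $ j)"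
  shows "\<bar>A i\<bar> \<le> K * (real n powr \<alpha> * power_sum \<Delta> x)"
proof -
  have "power_sum \<Delta> (real_vec i) \<le> power_sum \<Delta> (real n *\<^sub>R x)"
    using assms by (intro power_sum_antimono[OF exps]) auto
  also have "\<dots> = real n powr \<alpha> * power_sum \<Delta> x"
    using assms by (intro power_sum_scale[OF exps]) auto
  finally show ?thesis
    using dominated[OF assms(2)] K_nonneg by (meson mult_left_mono order_trans)
qed

text \<open>This is the bound for dominated convergence: after division by \<open>n\<^bsup>2\<alpha>\<^esup>\<close> its right-hand side does
  not depend on \<open>n\<close>. The coordinate 0 is excluded because \<open>powr\<close> has the value 0 at 0.\<close>
lemma lag_product_bound:
  assumes "n > 0" "\<And>j. x $ j \<noteq> 0"
  shows "\<bar>lag_product (int n) (cell n x)\<bar>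
    \<le> real n powr (2 * \<alpha>) * (K\<^sup>2 * (indicator pos_orthant x * (power_sum \<Delta> x * power_sum \<Delta> (1 + x))))"
proof (cases "cell n x \<in> offdiag_lattice")
  case True
  have pos: "0 < x $ j" for j
  proof -
    have "0 < cell n x $ j"
      using True by (simp only: offdiag_lattice_iff)
    then have "0 \<le> real n * x $ j" by simp
    then show ?thesis
      using assms(1) assms(2)[of j] by (simp add: zero_le_mult_iff)
  qed
  have shift: "shift_vec (int n) (cell n x) \<in> offdiag_lattice"
    using True by (intro shift_vec_offdiag) auto
  have le: "real n * x $ j \<le> of_int \<lfloor>real n * x $ j\<rfloor> + 1" for j by linarith
  have "\<bar>A (cell n x)\<bar> \<le> K * (real n powr \<alpha> * power_sum \<Delta> x)"
    using assms(1) True pos le by (intro A_bound) auto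
  moreover have "\<bar>A (shift_vec (int n) (cell n x))\<bar> \<le> K * (real n powr \<alpha> * power_sum \<Delta> (1 + x))"
    using assms(1) shift pos le
  proof (intro A_bound)
    show "real n * (1 + x) $ j \<le> of_int (shift_vec (int n) (cell n x) $ j)" for j
      using le[of j] by (simp add: distrib_left)
  qed (auto intro: add_pos_pos)
  ultimately have "\<bar>A (cell n x)\<bar> * \<bar>A (shift_vec (int n) (cell n x))\<bar>
      \<le> (K * (real n powr \<alpha> * power_sum \<Delta> x)) * (K * (real n powr \<alpha> * power_sum \<Delta> (1 + x)))"
    by (intro mult_mono) (auto intro!: mult_nonneg_nonneg K_nonneg power_sum_nonneg)
  also have "\<dots> = real n powr (2 * \<alpha>) * (K\<^sup>2 * (power_sum \<Delta> x * power_sum \<Delta> (1 + x)))"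
  proof -
    have "real n powr (2 * \<alpha>) = real n powr \<alpha> * real n powr \<alpha>"
      by (simp flip: powr_add)
    then show ?thesis by (simp add: power2_eq_square mult_ac)
  qed
  finally show ?thesis
    using True pos by (simp add: lag_product_def abs_mult pos_orthant_def)
qed (auto simp: lag_product_def intro!: mult_nonneg_nonneg power_sum_nonneg)

text \<open>Summability for an arbitrary lag, in particular for lag 0, has to avoid the square of the
  majorant at \<open>x\<close>, which is not integrable at the origin. On the grid of mesh 1 the corner also lies
  above \<open>(1 + x) / 2\<close>, so one of the two factors can be bounded by a multiple of the majorant at
  \<open>1 + x\<close>.\<close>
lemma lag_product_bound_unit:
  assumes "0 \<le> d" "\<And>j. x $ j \<noteq> 0"
  shows "\<bar>lag_product d (cell 1 x)\<bar>
    \<le> (1 / 2) powr \<alpha> * K\<^sup>2 * (indicator pos_orthant x * (power_sum \<Delta> x * power_sum \<Delta> (1 + x)))"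
proof (cases "cell 1 x \<in> offdiag_lattice")
  case True
  have floor_nonneg: "0 \<le> \<lfloor>x $ j\<rfloor>" for j
  proof -
    have "0 < cell 1 x $ j"
      using True by (simp only: offdiag_lattice_iff)
    then show ?thesis by simp
  qed
  have pos: "0 < x $ j" for j
    using floor_nonneg[of j] assms(2)[of j] by linarith
  have shift: "shift_vec d (cell 1 x) \<in> offdiag_lattice"
    using True assms(1) by (intro shift_vec_offdiag) auto
  have "x $ j \<le> of_int \<lfloor>x $ j\<rfloor> + 1" for j by linarith
  then have "\<bar>A (cell 1 x)\<bar> \<le> K * (real 1 powr \<alpha> * power_sum \<Delta> x)"
    using True pos by (intro A_bound) auto
  moreover have "\<bar>A (shift_vec d (cell 1 x))\<bar> \<le> K * (real 1 powr \<alpha> * power_sum \<Delta> ((1 / 2) *\<^sub>R (1 + x)))"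
  proof (rule A_bound)
    fix j
    have "0 \<le> real_of_int \<lfloor>x $ j\<rfloor>" "x $ j < of_int \<lfloor>x $ j\<rfloor> + 1"
      using floor_nonneg[of j] by simp_all
    moreover have "(1 + t) / 2 \<le> u + 1" if "0 \<le> u" "t < u + 1" for t u :: real
      using that by (simp add: field_simps)
    ultimately have "(1 + x $ j) / 2 \<le> of_int \<lfloor>x $ j\<rfloor> + 1"
      by blast
    then show "real 1 * ((1 / 2) *\<^sub>R (1 + x)) $ j \<le> of_int (shift_vec d (cell 1 x) $ j)"
      using assms(1) by simp
    show "0 < ((1 / 2) *\<^sub>R (1 + x)) $ j"
      using pos[of j] by simp
  qed (use shift in auto)
  ultimately have "\<bar>A (cell 1 x)\<bar> * \<bar>A (shift_vec d (cell 1 x))\<bar>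
      \<le> (K * (real 1 powr \<alpha> * power_sum \<Delta> x)) * (K * (real 1 powr \<alpha> * power_sum \<Delta> ((1 / 2) *\<^sub>R (1 + x))))"
    by (intro mult_mono) (auto intro!: mult_nonneg_nonneg K_nonneg power_sum_nonneg)
  also have "power_sum \<Delta> ((1 / 2) *\<^sub>R (1 + x)) = (1 / 2) powr \<alpha> * power_sum \<Delta> (1 + x)"
    using pos by (intro power_sum_scale[OF exps]) (auto intro: add_pos_pos)
  finally show ?thesis
    using True pos by (simp add: lag_product_def abs_mult pos_orthant_def power2_eq_square mult_ac)
qed (auto simp: lag_product_def intro!: mult_nonneg_nonneg power_sum_nonneg)

lemma measurable_lag_product:
  assumes "n > 0"
  shows "(\<lambda>x. lag_product d (cell n x)) \<in> borel_measurable borel"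
  by (rule measurable_compose[OF measurable_cell[OF assms]]) simp

lemma lag_product_abs_summable:
  assumes "0 \<le> d"
  shows "(\<lambda>i. \<bar>A i * A (shift_vec d i)\<bar>) summable_on offdiag_lattice"
proof -
  have "integrable lborel (\<lambda>x. lag_product d (cell 1 x))"
  proof (rule Bochner_Integration.integrable_bound)
    show "integrable lborel (\<lambda>x. (1 / 2) powr \<alpha> * K\<^sup>2 *
        (indicator pos_orthant x * (power_sum \<Delta> x * power_sum \<Delta> (1 + x))))"
      by (intro integrable_mult_right integrable_power_sum_mult[OF exps])
    have "AE x in (lborel :: (real ^ 'k) measure). inj (\<lambda>j. x $ j) \<and> (\<forall>j. x $ j \<noteq> 0)"
      using AE_lebesgue_inj_nth by (simp only: AE_completion_iff)
    then show "AE x in lborel. norm (lag_product d (cell 1 x)) \<le> norm ((1 / 2) powr \<alpha> * K\<^sup>2 *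
        (indicator pos_orthant x * (power_sum \<Delta> x * power_sum \<Delta> (1 + x))))"
    proof eventually_elim
      case (elim x)
      then show ?case
        unfolding real_norm_def
        by (intro order_trans[OF lag_product_bound_unit[OF assms, of x] abs_ge_self]) blast
    qed
    show "(\<lambda>x. lag_product d (cell 1 x)) \<in> borel_measurable lborel"
      unfolding measurable_lborel2 by (rule measurable_lag_product) simp
  qed
  then have "(\<lambda>i. \<bar>lag_product d i\<bar>) summable_on UNIV"
    by (rule has_sum_lattice_integral(2)[OF zero_less_one])
  moreover have "(\<lambda>i. \<bar>A i * A (shift_vec d i)\<bar>) summable_on offdiag_lattice
      \<longleftrightarrow> (\<lambda>i. \<bar>lag_product d i\<bar>) summable_on UNIV"
    by (rule summable_on_cong_neutral) (auto simp: lag_product_def)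
  ultimately show ?thesis by simp
qed

lemma has_sum_R:
  assumes "0 \<le> d"
  shows "((\<lambda>i. A i * A (shift_vec d i)) has_sum R d) offdiag_lattice"
proof -
  have "(\<lambda>i. norm (A i * A (shift_vec d i))) summable_on offdiag_lattice"
    unfolding real_norm_def by (rule lag_product_abs_summable[OF assms])
  then show ?thesis
    unfolding R_def by (rule has_sum_infsum[OF abs_summable_summable])
qed

text \<open>Almost every \<open>x\<close> has nonzero and pairwise distinct coordinates; for such positive \<open>x\<close> the corner
  of its cell eventually has distinct entries too, so the omitted diagonals disappear in the limit.\<close>
theorem R_asymptotics:
  fixes f :: "real ^ 'k \<Rightarrow> real"
  assumes lim: "AE x in lebesgue. x \<in> pos_orthant \<longrightarrow> (\<lambda>n. real n powr (- \<alpha>) * A (cell n x)) \<longlonglongrightarrow> f x"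
  shows "(\<lambda>n. real n powr (- 2 * \<alpha> - real CARD('k)) * R (int n)) \<longlonglongrightarrow> kernel_constant f"
proof -
  define s where "s n x = real n powr (- 2 * \<alpha>) * lag_product (int n) (cell n x)" for n x
  define h where "h x = indicator pos_orthant x * (f x * f (1 + x))" for x
  define w where "w x = K\<^sup>2 * (indicator pos_orthant x * (power_sum \<Delta> x * power_sum \<Delta> (1 + x)))" for x
  have s_borel: "s (Suc n) \<in> borel_measurable lborel" for n
  proof -
    have "(\<lambda>x. lag_product (int (Suc n)) (cell (Suc n) x)) \<in> borel_measurable lborel"
      unfolding measurable_lborel2 by (rule measurable_lag_product) simp
    then show ?thesis
      unfolding s_def by (rule borel_measurable_times[OF borel_measurable_const])
  qed
  have s_meas: "s (Suc n) \<in> borel_measurable lebesgue" for n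
    by (rule measurable_completion[OF s_borel])
  have w_borel: "integrable lborel w"
    unfolding w_def by (intro integrable_mult_right integrable_power_sum_mult[OF exps])
  have w_int: "integrable lebesgue w"
    using w_borel integrable_completion[OF borel_measurable_integrable[OF w_borel]] by (rule iffD2[rotated])
  have s_lim0: "AE x in lebesgue. (\<lambda>n. s n x) \<longlonglongrightarrow> h x"
    using lim AE_lebesgue_translation[OF lim, of 1] AE_lebesgue_inj_nth
  proof eventually_elim
    case (elim x)
    show ?case
    proof (cases "x \<in> pos_orthant")
      case True
      have "(\<lambda>n. (real n powr (- \<alpha>) * A (cell n x)) * (real n powr (- \<alpha>) * A (cell n (1 + x))))
          \<longlonglongrightarrow> f x * f (1 + x)"
      proof (rule tendsto_mult)
        have "1 + x \<in> pos_orthant"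
          using True by (simp add: pos_orthant_def add_pos_pos)
        then show "(\<lambda>n. real n powr (- \<alpha>) * A (cell n (1 + x))) \<longlonglongrightarrow> f (1 + x)"
          using elim by blast
      qed (use elim True in blast)
      moreover have "\<forall>\<^sub>F n in sequentially.
          (real n powr (- \<alpha>) * A (cell n x)) * (real n powr (- \<alpha>) * A (cell n (1 + x))) = s n x"
        using cell_offdiag_eventually[OF True conjunct1[OF elim(3)]]
      proof eventually_elim
        case (elim n)
        have "real n powr (- 2 * \<alpha>) = real n powr (- \<alpha>) * real n powr (- \<alpha>)"
          by (simp flip: powr_add)
        with elim show ?case
          by (simp add: s_def lag_product_def shift_vec_cell mult_ac)
      qed
      ultimately have "(\<lambda>n. s n x) \<longlonglongrightarrow> f x * f (1 + x)"
        by (rule Lim_transform_eventually)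
      then show ?thesis
        using True by (simp add: h_def)
    next
      case False
      then obtain j where "\<not> 0 < x $ j"
        by (auto simp: pos_orthant_def)
      moreover have "x $ j \<noteq> 0"
        using elim(3) by blast
      ultimately have "x $ j < 0" by linarith
      then have "cell n x \<notin> offdiag_lattice" if "n > 0" for n
      proof -
        have "real n * x $ j < 0"
          using that \<open>x $ j < 0\<close> by (simp add: mult_pos_neg)
        then have "\<not> 0 < cell n x $ j" by simp
        then show ?thesis by (auto simp: offdiag_lattice_iff)
      qed
      then have "s n x = 0" if "n > 0" for n
        using that by (simp add: s_def lag_product_def)
      then have "\<forall>\<^sub>F n in sequentially. s n x = 0"
        by (rule eventually_mono[OF eventually_gt_at_top[of 0]])
      then show ?thesis
        using False by (simp add: h_def tendsto_eventually)
    qed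
  qed
  then have s_lim: "AE x in lebesgue. (\<lambda>n. s (Suc n) x) \<longlonglongrightarrow> h x"
    by eventually_elim (rule LIMSEQ_Suc)
  have s_bound: "AE x in lebesgue. norm (s (Suc n) x) \<le> w x" for n
    using AE_lebesgue_inj_nth
  proof eventually_elim
    case (elim x)
    have "real (Suc n) powr (- 2 * \<alpha>) * \<bar>lag_product (int (Suc n)) (cell (Suc n) x)\<bar>
        \<le> real (Suc n) powr (- 2 * \<alpha>) * (real (Suc n) powr (2 * \<alpha>) * w x)"
      using elim unfolding w_def by (intro mult_left_mono lag_product_bound) auto
    also have "\<dots> = w x"
      by (simp add: powr_add[symmetric] mult.assoc[symmetric] del: of_nat_Suc)
    finally show ?case
      by (simp add: s_def abs_mult del: of_nat_Suc)
  qed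
  have h_meas: "h \<in> borel_measurable lebesgue"
    by (rule borel_measurable_lebesgue_AE_limit[OF s_meas s_lim])
  have s_int: "integrable lborel (s (Suc n))" for n
    using integrable_dominated_convergence2[OF h_meas s_meas w_int s_lim s_bound]
      iffD1[OF integrable_completion[OF s_borel]] by blast
  have "(\<lambda>n. integral\<^sup>L lebesgue (s (Suc n))) \<longlonglongrightarrow> integral\<^sup>L lebesgue h"
    by (rule integral_dominated_convergence[OF h_meas s_meas w_int s_lim s_bound])
  moreover have "integral\<^sup>L lebesgue (s (Suc n))
      = real (Suc n) powr (- 2 * \<alpha> - real CARD('k)) * R (int (Suc n))" for n
  proof -
    let ?m = "Suc n"
    have "lag_product (int ?m) (cell ?m x) = real ?m powr (2 * \<alpha>) * s ?m x" for x
      by (simp add: s_def powr_add[symmetric] mult.assoc[symmetric] del: of_nat_Suc)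
    then have "integrable lborel (\<lambda>x. lag_product (int ?m) (cell ?m x))"
      using integrable_mult_right[OF s_int[of n], of "real ?m powr (2 * \<alpha>)"] by simp
    then have "(lag_product (int ?m) has_sum
        (real ?m ^ CARD('k) * (\<integral>x. lag_product (int ?m) (cell ?m x) \<partial>lborel))) UNIV"
      by (intro has_sum_lattice_integral) auto
    then have "((\<lambda>i. A i * A (shift_vec (int ?m) i)) has_sum
        (real ?m ^ CARD('k) * (\<integral>x. lag_product (int ?m) (cell ?m x) \<partial>lborel))) offdiag_lattice"
      by (subst has_sum_cong_neutral[where T = UNIV]) (auto simp: lag_product_def)
    then have "R (int ?m) = real ?m ^ CARD('k) * (\<integral>x. lag_product (int ?m) (cell ?m x) \<partial>lborel)"
      unfolding R_def by (rule infsumI)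
    moreover have "integral\<^sup>L lebesgue (s ?m)
        = real ?m powr (- 2 * \<alpha>) * (\<integral>x. lag_product (int ?m) (cell ?m x) \<partial>lborel)"
      unfolding integral_completion[OF s_borel] by (simp add: s_def[abs_def] del: of_nat_Suc)
    ultimately show ?thesis
      by (simp add: powr_diff powr_realpow del: of_nat_Suc)
  qed
  ultimately have "(\<lambda>n. real (Suc n) powr (- 2 * \<alpha> - real CARD('k)) * R (int (Suc n)))
      \<longlonglongrightarrow> kernel_constant f"
    by (simp add: kernel_constant_def set_lebesgue_integral_def h_def[abs_def] del: of_nat_Suc)
  then show ?thesis
    by (rule LIMSEQ_imp_Suc)
qed

end

section \<open>From covariances to variances of partial sums\<close>

text \<open>Summing the estimate \<open>|\<Delta>a - l \<Delta>b| \<le> (e/2) \<Delta>b\<close> from \<open>N\<close> on bounds \<open>a - l b\<close> by a constant plus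
  \<open>(e/2) b\<close>, and the constant is negligible since \<open>b\<close> is unbounded.\<close>
lemma stolz_cesaro:
  fixes a b :: "nat \<Rightarrow> real"
  assumes mono: "\<And>n. b n < b (Suc n)" and b: "filterlim b at_top sequentially"
    and lim: "(\<lambda>n. (a (Suc n) - a n) / (b (Suc n) - b n)) \<longlonglongrightarrow> l"
  shows "(\<lambda>n. a n / b n) \<longlonglongrightarrow> l"
proof (rule tendstoI)
  fix e :: real assume e: "e > 0"
  have "\<forall>\<^sub>F n in sequentially. dist ((a (Suc n) - a n) / (b (Suc n) - b n)) l < e / 2"
    using e by (intro tendstoD[OF lim]) simp
  then obtain N where N: "\<And>n. n \<ge> N \<Longrightarrow> dist ((a (Suc n) - a n) / (b (Suc n) - b n)) l < e / 2"
    by (auto simp: eventually_at_top_linorder)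
  define c where "c n = a n - l * b n" for n
  have step: "\<bar>c (Suc n) - c n\<bar> \<le> e / 2 * (b (Suc n) - b n)" if "n \<ge> N" for n
  proof -
    have pos: "b (Suc n) - b n > 0" using mono[of n] by simp
    have "c (Suc n) - c n = ((a (Suc n) - a n) / (b (Suc n) - b n) - l) * (b (Suc n) - b n)"
      using pos by (simp add: c_def field_simps)
    then have "\<bar>c (Suc n) - c n\<bar> = dist ((a (Suc n) - a n) / (b (Suc n) - b n)) l * (b (Suc n) - b n)"
      using pos by (simp add: dist_real_def abs_mult)
    then show ?thesis
      using N[OF that] pos by (simp add: less_imp_le mult_right_mono)
  qed
  have tele: "\<bar>c n - c N\<bar> \<le> e / 2 * (b n - b N)" if "n \<ge> N" for n
    using that
  proof (induction n rule: dec_induct)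
    case (step n)
    have "\<bar>c (Suc n) - c N\<bar> \<le> \<bar>c (Suc n) - c n\<bar> + \<bar>c n - c N\<bar>" by linarith
    also have "\<dots> \<le> e / 2 * (b (Suc n) - b n) + e / 2 * (b n - b N)"
      using step.IH step.hyps \<open>\<And>n. N \<le> n \<Longrightarrow> \<bar>c (Suc n) - c n\<bar> \<le> e / 2 * (b (Suc n) - b n)\<close>
      by (intro add_mono) auto
    also have "\<dots> = e / 2 * ((b (Suc n) - b n) + (b n - b N))"
      by (simp only: distrib_left)
    finally show ?case by simp
  qed simp
  define D where "D = \<bar>c N\<bar> + e / 2 * \<bar>b N\<bar>"
  have D: "D \<ge> 0" using e by (simp add: D_def)
  have "\<forall>\<^sub>F n in sequentially. b n > 2 * D / e + 1"
    using b by (simp add: filterlim_at_top_dense)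
  then show "\<forall>\<^sub>F n in sequentially. dist (a n / b n) l < e"
    using eventually_ge_at_top[of N]
  proof eventually_elim
    case (elim n)
    have "0 \<le> 2 * D / e" using D e by simp
    with elim have bpos: "b n > 0" by linarith
    have "2 * D / e < b n" using elim by linarith
    then have Dlt: "D < e / 2 * b n"
      using e by (simp add: field_simps)
    have "\<bar>c n\<bar> \<le> \<bar>c n - c N\<bar> + \<bar>c N\<bar>" by linarith
    also have "\<dots> \<le> e / 2 * (b n - b N) + \<bar>c N\<bar>"
      using tele[OF elim(2)] by simp
    also have "\<dots> \<le> e / 2 * b n + D"
    proof -
      have "e / 2 * (- b N) \<le> e / 2 * \<bar>b N\<bar>"
        using e by (intro mult_left_mono) auto
      then show ?thesis by (simp add: D_def right_diff_distrib)
    qed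
    also have "\<dots> < e * b n"
      using Dlt by simp
    finally have "\<bar>c n\<bar> < e * b n" .
    moreover have "a n / b n - l = c n / b n"
      using bpos by (simp add: c_def field_simps)
    ultimately show ?case
      using bpos by (simp add: dist_real_def field_simps)
  qed
qed

text \<open>Compare with \<open>b n = n\<^bsup>p+1\<^esup>\<close>, whose increments are asymptotic to \<open>(p + 1) n\<^sup>p\<close>.\<close>
lemma partial_sum_asymptotics:
  fixes r :: "nat \<Rightarrow> real"
  assumes p: "-1 < p" "p < 0" and lim: "(\<lambda>n. r n / real n powr p) \<longlonglongrightarrow> c"
  shows "(\<lambda>n. (\<Sum>d=1..n. r d) / real n powr (p + 1)) \<longlonglongrightarrow> c / (p + 1)"
proof (rule stolz_cesaro)
  show "real n powr (p + 1) < real (Suc n) powr (p + 1)" for n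
    using p by (intro powr_less_mono2) auto
  show "filterlim (\<lambda>n. real n powr (p + 1)) at_top sequentially"
    using p by real_asymp
  have "(\<lambda>n. r (Suc n) / real (Suc n) powr p) \<longlonglongrightarrow> c"
    by (rule LIMSEQ_Suc[OF lim])
  moreover have "(\<lambda>n. real (Suc n) powr p / (real (Suc n) powr (p + 1) - real n powr (p + 1))) \<longlonglongrightarrow> 1 / (p + 1)"
    using p by real_asymp (simp add: inverse_eq_divide)
  ultimately have "(\<lambda>n. r (Suc n) / real (Suc n) powr p *
      (real (Suc n) powr p / (real (Suc n) powr (p + 1) - real n powr (p + 1)))) \<longlonglongrightarrow> c * (1 / (p + 1))"
    by (rule tendsto_mult)
  then show "(\<lambda>n. ((\<Sum>d=1..Suc n. r d) - (\<Sum>d=1..n. r d)) /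
      (real (Suc n) powr (p + 1) - real n powr (p + 1))) \<longlonglongrightarrow> c / (p + 1)"
    by (simp del: of_nat_Suc)
qed

definition variance_sum :: "(int \<Rightarrow> real) \<Rightarrow> nat \<Rightarrow> real" where
  "variance_sum r N = (\<Sum>n=1..N. \<Sum>m=1..N. r \<bar>int n - int m\<bar>)"

text \<open>Enlarging the square \<open>{1..N}\<^sup>2\<close> by one adds the corner, at lag 0, and two edges, each of which
  runs through the lags \<open>1, \<dots>, N\<close>.\<close>
lemma variance_sum_Suc:
  "variance_sum r (Suc N) - variance_sum r N = r 0 + 2 * (\<Sum>d=1..N. r (int d))"
proof -
  have "(\<Sum>d=1..N. r (int d)) = (\<Sum>d=1..N. r (int (N + 1 - d)))"
    by (rule sum.atLeastAtMost_rev)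
  also have "\<dots> = (\<Sum>m=1..N. r \<bar>int (Suc N) - int m\<bar>)"
    by (intro sum.cong) (auto simp: of_nat_diff)
  finally have *: "(\<Sum>d=1..N. r (int d)) = (\<Sum>m=1..N. r \<bar>int (Suc N) - int m\<bar>)" .
  then have **: "(\<Sum>d=1..N. r (int d)) = (\<Sum>m=1..N. r \<bar>int m - int (Suc N)\<bar>)"
    by (simp only: abs_minus_commute)
  have "variance_sum r (Suc N) = variance_sum r N
      + (\<Sum>n=1..N. r \<bar>int n - int (Suc N)\<bar>) + ((\<Sum>m=1..N. r \<bar>int (Suc N) - int m\<bar>) + r 0)"
    unfolding variance_sum_def by (simp add: sum.distrib del: of_nat_Suc)
  then show ?thesis
    unfolding *[symmetric] **[symmetric] by simp
qed

lemma variance_sum_asymptotics: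
  fixes r :: "int \<Rightarrow> real"
  assumes p: "-1 < p" "p < 0" and lim: "(\<lambda>n. r (int n) / real n powr p) \<longlonglongrightarrow> c"
  shows "(\<lambda>N. variance_sum r N / real N powr (p + 2)) \<longlonglongrightarrow> 2 * c / ((p + 1) * (p + 2))"
proof (rule stolz_cesaro)
  show "real n powr (p + 2) < real (Suc n) powr (p + 2)" for n
    using p by (intro powr_less_mono2) auto
  show "filterlim (\<lambda>n. real n powr (p + 2)) at_top sequentially"
    using p by real_asymp
  have "(\<lambda>n. r 0 / real n powr (p + 1)) \<longlonglongrightarrow> 0"
    using p by real_asymp
  then have "(\<lambda>n. r 0 / real n powr (p + 1) + 2 * ((\<Sum>d=1..n. r (int d)) / real n powr (p + 1)))
      \<longlonglongrightarrow> 0 + 2 * (c / (p + 1))"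
    using p lim by (intro tendsto_intros partial_sum_asymptotics)
  moreover have "(\<lambda>n. real n powr (p + 1) / (real (Suc n) powr (p + 2) - real n powr (p + 2))) \<longlonglongrightarrow> 1 / (p + 2)"
    using p by real_asymp (simp add: inverse_eq_divide)
  ultimately have lim: "(\<lambda>n. (r 0 / real n powr (p + 1) + 2 * ((\<Sum>d=1..n. r (int d)) / real n powr (p + 1)))
      * (real n powr (p + 1) / (real (Suc n) powr (p + 2) - real n powr (p + 2))))
      \<longlonglongrightarrow> (0 + 2 * (c / (p + 1))) * (1 / (p + 2))"
    by (rule tendsto_mult)
  have eq: "(0 + 2 * (c / (p + 1))) * (1 / (p + 2)) = 2 * c / ((p + 1) * (p + 2))"
    using p by (simp add: field_simps)
  have ev: "\<forall>\<^sub>F n in sequentially.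
      (r 0 / real n powr (p + 1) + 2 * ((\<Sum>d=1..n. r (int d)) / real n powr (p + 1)))
      * (real n powr (p + 1) / (real (Suc n) powr (p + 2) - real n powr (p + 2)))
      = (variance_sum r (Suc n) - variance_sum r n) / (real (Suc n) powr (p + 2) - real n powr (p + 2))"
    using eventually_gt_at_top[of 0]
  proof eventually_elim
    case (elim n)
    then show ?case
      unfolding variance_sum_Suc by (simp add: add_divide_distrib[symmetric] del: of_nat_Suc)
  qed
  show "(\<lambda>n. (variance_sum r (Suc n) - variance_sum r n) /
      (real (Suc n) powr (p + 2) - real n powr (p + 2))) \<longlonglongrightarrow> 2 * c / ((p + 1) * (p + 2))"
    by (rule Lim_transform_eventually[OF lim[unfolded eq] ev])
qed

section \<open>Symmetrized coefficients\<close>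

definition sym_coeff :: "(int ^ 'k \<Rightarrow> real) \<Rightarrow> int ^ 'k::finite \<Rightarrow> real" where
  "sym_coeff a i = 1 / fact CARD('k) * (\<Sum>\<sigma>\<in>perms. a (perm_vec \<sigma> i))"

lemma card_perms: "card (perms :: ('k::finite \<Rightarrow> 'k) set) = fact CARD('k)"
  by (rule card_permutations) auto

lemma perm_vec_perm_vec: "perm_vec \<sigma> (perm_vec \<tau> x) = perm_vec (\<tau> \<circ> \<sigma>) x"
  by (simp add: vec_eq_iff)

lemma perm_vec_shift_vec: "perm_vec \<sigma> (shift_vec n i) = shift_vec n (perm_vec \<sigma> i)"
  by (simp add: vec_eq_iff)

lemma perm_vec_real_vec: "real_vec (perm_vec \<sigma> i) = perm_vec \<sigma> (real_vec i)"
  by (simp add: vec_eq_iff)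

lemma perm_vec_pos_orthant: "x \<in> pos_orthant \<Longrightarrow> perm_vec \<sigma> x \<in> pos_orthant"
  by (simp add: pos_orthant_def)

lemma symmetrization_eq: "symmetrization f x = 1 / fact CARD('k) * (\<Sum>\<sigma>\<in>perms. f (perm_vec \<sigma> x))"
  for f :: "real ^ 'k::finite \<Rightarrow> real"
  by (simp add: symmetrization_def perm_vec_def)

lemma sym_coeff_perm_vec:
  assumes \<tau>: "\<tau> permutes UNIV"
  shows "sym_coeff a (perm_vec \<tau> i) = sym_coeff a i"
proof -
  have "(\<Sum>\<sigma>\<in>perms. a (perm_vec \<sigma> (perm_vec \<tau> i))) = (\<Sum>\<sigma>\<in>perms. a (perm_vec \<sigma> i))"
    unfolding perm_vec_perm_vec
  proof (rule sum.reindex_bij_witness[of _ "\<lambda>\<sigma>. inv \<tau> \<circ> \<sigma>" "\<lambda>\<sigma>. \<tau> \<circ> \<sigma>"])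
    show "inv \<tau> \<circ> (\<tau> \<circ> \<sigma>) = \<sigma>" "\<tau> \<circ> (inv \<tau> \<circ> \<sigma>) = \<sigma>" for \<sigma> :: "'a \<Rightarrow> 'a"
      using permutes_inv_o[OF \<tau>] by (simp_all add: o_assoc)
  qed (use \<tau> permutes_inv[OF \<tau>] in \<open>auto intro: permutes_compose\<close>)
  then show ?thesis by (simp add: sym_coeff_def)
qed

lemma bij_betw_perm_vec_offdiag:
  assumes \<sigma>: "\<sigma> permutes UNIV"
  shows "bij_betw (perm_vec \<sigma>) offdiag_lattice (offdiag_lattice :: (int ^ 'k::finite) set)"
proof (rule bij_betw_byWitness[where f' = "perm_vec (inv \<sigma>)"])
  show "\<forall>i\<in>offdiag_lattice. perm_vec (inv \<sigma>) (perm_vec \<sigma> i) = (i :: int ^ 'k)"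
    "\<forall>i\<in>offdiag_lattice. perm_vec \<sigma> (perm_vec (inv \<sigma>) i) = (i :: int ^ 'k)"
    using permutes_inverses[OF \<sigma>] by (simp_all add: vec_eq_iff)
qed (use perm_vec_offdiag[OF \<sigma>] perm_vec_offdiag[OF permutes_inv[OF \<sigma>]] in auto)

lemma has_sum_finite_sum:
  fixes f :: "'i \<Rightarrow> 'b \<Rightarrow> real"
  assumes "finite I" "\<And>j. j \<in> I \<Longrightarrow> (f j has_sum s j) B"
  shows "((\<lambda>x. \<Sum>j\<in>I. f j x) has_sum (\<Sum>j\<in>I. s j)) B"
  using assms by (induction I rule: finite_induct) (auto intro: has_sum_add)

text \<open>The second factor is already a symmetrization and hence invariant under permutations. Reindexing
  the sum by each permutation in turn and averaging symmetrizes the first factor as well.\<close>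
lemma has_sum_symmetrize:
  fixes a :: "int ^ 'k::finite \<Rightarrow> real"
  assumes "((\<lambda>i. a i * (\<Sum>\<sigma>\<in>perms. a (perm_vec \<sigma> (shift_vec n i)))) has_sum S) offdiag_lattice"
  shows "((\<lambda>i. fact CARD('k) * (sym_coeff a i * sym_coeff a (shift_vec n i))) has_sum S) offdiag_lattice"
proof -
  have "((\<lambda>i. a i * sym_coeff a (shift_vec n i)) has_sum (S / fact CARD('k))) offdiag_lattice"
    using has_sum_cmult_right[OF assms, of "1 / fact CARD('k)"] by (simp add: sym_coeff_def algebra_simps)
  then have one: "((\<lambda>i. a (perm_vec \<sigma> i) * sym_coeff a (shift_vec n i)) has_sum (S / fact CARD('k))) offdiag_lattice"
    if \<sigma>: "\<sigma> permutes UNIV" for \<sigma> :: "'k \<Rightarrow> 'k"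
    using has_sum_reindex_bij_betw[OF bij_betw_perm_vec_offdiag[OF \<sigma>],
        of "\<lambda>i. a i * sym_coeff a (shift_vec n i)" "S / fact CARD('k)"]
    by (simp add: sym_coeff_perm_vec[OF \<sigma>] flip: perm_vec_shift_vec)
  have "((\<lambda>i. \<Sum>\<sigma>\<in>perms. a (perm_vec \<sigma> i) * sym_coeff a (shift_vec n i))
      has_sum (\<Sum>\<sigma>\<in>(perms :: ('k \<Rightarrow> 'k) set). S / fact CARD('k))) offdiag_lattice"
    by (rule has_sum_finite_sum) (auto intro: one)
  moreover have "(\<Sum>\<sigma>\<in>perms. a (perm_vec \<sigma> i) * sym_coeff a (shift_vec n i))
      = fact CARD('k) * (sym_coeff a i * sym_coeff a (shift_vec n i))" for i
    unfolding sum_distrib_right[symmetric] by (simp add: sym_coeff_def[of a i])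
  ultimately show ?thesis
    by (simp add: card_perms)
qed

text \<open>Once the coefficients are replaced by their absolute values, every term is nonnegative, so
  adding all rearrangements of the exponents only enlarges the sum; it also makes it symmetric.\<close>
lemma class_L_majorant_bound:
  fixes h :: "real ^ 'k::finite \<Rightarrow> real"
  assumes "class_L_majorant \<alpha> h"
  obtains K \<Delta> where "0 \<le> K" "exponents \<alpha> \<Delta>" "\<And>x. x \<in> pos_orthant \<Longrightarrow> h x \<le> K * power_sum \<Delta> x"
proof -
  obtain m and c :: "nat \<Rightarrow> real" and \<gamma> :: "nat \<Rightarrow> 'k \<Rightarrow> real" where
    \<gamma>: "\<And>l. l < m \<Longrightarrow> (\<forall>j. \<gamma> l j \<in> {-1<..<-1/2}) \<and> (\<Sum>j\<in>UNIV. \<gamma> l j) = \<alpha>"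
    and h: "\<And>x. x \<in> pos_orthant \<Longrightarrow> h x = (\<Sum>l<m. c l * (\<Prod>j\<in>UNIV. x $ j powr \<gamma> l j))"
    using assms unfolding class_L_majorant_def by blast
  define \<Delta> where "\<Delta> = (\<lambda>(l, \<sigma>). \<gamma> l \<circ> \<sigma>) ` ({..<m} \<times> perms)"
  have fin: "finite \<Delta>" by (simp add: \<Delta>_def)
  have "exponents \<alpha> \<Delta>"
    unfolding exponents_def
  proof (intro conjI ballI fin)
    fix \<delta> assume "\<delta> \<in> \<Delta>"
    then obtain l \<sigma> where l: "l < m" and \<sigma>: "\<sigma> permutes UNIV" and \<delta>: "\<delta> = \<gamma> l \<circ> \<sigma>"
      by (auto simp: \<Delta>_def)
    show "\<forall>j. \<delta> j \<in> {-1<..<-1/2}"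
      using \<gamma>[OF l] by (simp add: \<delta>)
    show "(\<Sum>j\<in>UNIV. \<delta> j) = \<alpha>"
      using \<gamma>[OF l] sum.permute[OF \<sigma>, of "\<gamma> l"] by (simp add: \<delta>)
    fix \<tau> :: "'k \<Rightarrow> 'k" assume "\<tau> \<in> perms"
    then have "\<sigma> \<circ> \<tau> \<in> perms" using \<sigma> by (auto intro: permutes_compose)
    then show "\<delta> \<circ> \<tau> \<in> \<Delta>"
      using l by (auto simp: \<Delta>_def \<delta> o_assoc[symmetric] intro!: image_eqI[of _ _ "(l, \<sigma> \<circ> \<tau>)"])
  qed
  moreover have "h x \<le> (\<Sum>l<m. \<bar>c l\<bar>) * power_sum \<Delta> x" if x: "x \<in> pos_orthant" for x
  proof -
    have "c l * (\<Prod>j\<in>UNIV. x $ j powr \<gamma> l j) \<le> \<bar>c l\<bar> * power_sum \<Delta> x" if "l < m" for l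
    proof -
      have "id \<in> (perms :: ('k \<Rightarrow> 'k) set)" by (simp add: permutes_id)
      then have "\<gamma> l \<in> \<Delta>"
        using that by (auto simp: \<Delta>_def intro!: image_eqI[of _ _ "(l, id)"])
      then have le: "(\<Prod>j\<in>UNIV. x $ j powr \<gamma> l j) \<le> power_sum \<Delta> x"
        unfolding power_sum_def using fin
        by (intro member_le_sum[of "\<gamma> l" \<Delta> "\<lambda>\<delta>. \<Prod>j\<in>UNIV. x $ j powr \<delta> j"]) (auto intro: prod_nonneg)
      have "c l * (\<Prod>j\<in>UNIV. x $ j powr \<gamma> l j) \<le> \<bar>c l\<bar> * (\<Prod>j\<in>UNIV. x $ j powr \<gamma> l j)"
        by (intro mult_right_mono prod_nonneg) auto
      also have "\<dots> \<le> \<bar>c l\<bar> * power_sum \<Delta> x"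
        using le by (intro mult_left_mono) auto
      finally show ?thesis .
    qed
    then show ?thesis
      unfolding h[OF x] sum_distrib_right by (intro sum_mono) auto
  qed
  ultimately show ?thesis
    by (intro that[of "\<Sum>l<m. \<bar>c l\<bar>" \<Delta>]) (auto intro: sum_nonneg)
qed

lemma offdiag_subset_pos_lattice: "i \<in> offdiag_lattice \<Longrightarrow> i \<in> pos_lattice"
  by (simp add: offdiag_lattice_def)

lemma real_vec_pos_orthant: "i \<in> pos_lattice \<Longrightarrow> real_vec i \<in> pos_orthant"
  by (simp add: pos_lattice_def pos_orthant_def)

lemma power_dominated_sym_coeff:
  fixes g :: "real ^ 'k::finite \<Rightarrow> real"
  assumes "lattice_dominated \<alpha> g" and L: "admissible_factor L"
  obtains K \<Delta> where "power_dominated \<alpha> K \<Delta> (sym_coeff (\<lambda>i. g (real_vec i) * L i))"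
proof -
  obtain h where h: "class_L_majorant \<alpha> h" "\<And>i. i \<in> offdiag_lattice \<Longrightarrow> \<bar>g (real_vec i)\<bar> \<le> h (real_vec i)"
    using assms unfolding lattice_dominated_def by blast
  obtain K \<Delta> where K: "0 \<le> K" and \<Delta>: "exponents \<alpha> \<Delta>"
    and hK: "\<And>x. x \<in> pos_orthant \<Longrightarrow> h x \<le> K * power_sum \<Delta> x"
    using class_L_majorant_bound[OF h(1)] by metis
  obtain B where B: "\<And>i. i \<in> pos_lattice \<Longrightarrow> \<bar>L i\<bar> \<le> B"
    using L unfolding admissible_factor_def by blast
  define a where "a i = g (real_vec i) * L i" for i
  have bound: "\<bar>a i\<bar> \<le> K * \<bar>B\<bar> * power_sum \<Delta> (real_vec i)" if i: "i \<in> offdiag_lattice" for i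
  proof -
    have "\<bar>g (real_vec i)\<bar> \<le> K * power_sum \<Delta> (real_vec i)"
      using h(2)[OF i] hK[OF real_vec_pos_orthant[OF offdiag_subset_pos_lattice[OF i]]] by linarith
    moreover have "\<bar>L i\<bar> \<le> \<bar>B\<bar>"
      using B[OF offdiag_subset_pos_lattice[OF i]] by linarith
    ultimately have "\<bar>g (real_vec i)\<bar> * \<bar>L i\<bar> \<le> (K * power_sum \<Delta> (real_vec i)) * \<bar>B\<bar>"
      by (intro mult_mono) (auto intro!: mult_nonneg_nonneg K power_sum_nonneg)
    then show ?thesis by (simp add: a_def abs_mult mult_ac)
  qed
  have "power_dominated \<alpha> (K * \<bar>B\<bar>) \<Delta> (sym_coeff a)"
  proof
    show "exponents \<alpha> \<Delta>" by (rule \<Delta>)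
    show "0 \<le> K * \<bar>B\<bar>" using K by simp
    fix i :: "int ^ 'k" assume i: "i \<in> offdiag_lattice"
    have "\<bar>\<Sum>\<sigma>\<in>perms. a (perm_vec \<sigma> i)\<bar> \<le> (\<Sum>\<sigma>\<in>perms. \<bar>a (perm_vec \<sigma> i)\<bar>)"
      by (rule sum_abs)
    also have "\<dots> \<le> (\<Sum>\<sigma>\<in>(perms :: ('k \<Rightarrow> 'k) set). K * \<bar>B\<bar> * power_sum \<Delta> (real_vec i))"
    proof (rule sum_mono)
      fix \<sigma> :: "'k \<Rightarrow> 'k" assume "\<sigma> \<in> perms"
      then have \<sigma>: "\<sigma> permutes UNIV" by simp
      show "\<bar>a (perm_vec \<sigma> i)\<bar> \<le> K * \<bar>B\<bar> * power_sum \<Delta> (real_vec i)"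
        using bound[OF perm_vec_offdiag[OF \<sigma> i]]
        by (simp add: perm_vec_real_vec power_sum_perm_vec[OF \<Delta> \<sigma>])
    qed
    also have "\<dots> = fact CARD('k) * (K * \<bar>B\<bar> * power_sum \<Delta> (real_vec i))"
      by (simp add: card_perms)
    finally show "\<bar>sym_coeff a i\<bar> \<le> K * \<bar>B\<bar> * power_sum \<Delta> (real_vec i)"
      by (simp add: sym_coeff_def abs_mult divide_le_eq mult.commute)
  qed
  then show ?thesis
    using that unfolding a_def[abs_def] by blast
qed

locale homogeneous_kernel =
  fixes \<alpha> :: real and g :: "real ^ 'k::finite \<Rightarrow> real"
  assumes homogeneous: "\<And>c x. 0 < c \<Longrightarrow> x \<in> pos_orthant \<Longrightarrow> g (c *\<^sub>R x) = c powr \<alpha> * g x"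
    and AE_continuous: "AE x in lebesgue. x \<in> pos_orthant \<longrightarrow> continuous (at x within pos_orthant) g"
begin

text \<open>The admissibility of \<open>L\<close> is applied with the constant offset \<open>B = 1\<close>, since the corner of the
  cell of \<open>x\<close> is \<open>[nx] + 1\<close>.\<close>
lemma kernel_cell_tendsto:
  assumes x: "x \<in> pos_orthant" and cont: "continuous (at x within pos_orthant) g"
    and L: "admissible_factor L"
  shows "(\<lambda>n. real n powr (- \<alpha>) * (g (real_vec (cell n x)) * L (cell n x))) \<longlonglongrightarrow> g x"
proof -
  have L_shift: "(\<lambda>n. L (floor_vec (real n *\<^sub>R x) + B n)) \<longlonglongrightarrow> 1"
    if "\<exists>b. \<forall>n j. \<bar>B n $ j\<bar> \<le> b" for B :: "nat \<Rightarrow> int ^ 'k"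
    using L x that unfolding admissible_factor_def by blast
  have "(\<lambda>n. L (floor_vec (real n *\<^sub>R x) + 1)) \<longlonglongrightarrow> 1"
    by (rule L_shift) (auto intro: exI[of _ 1])
  moreover have "floor_vec (real n *\<^sub>R x) + 1 = cell n x" for n
    by (simp add: vec_eq_iff floor_vec_def)
  ultimately have L_lim: "(\<lambda>n. L (cell n x)) \<longlonglongrightarrow> 1" by simp
  have pos: "real_vec (cell n x) \<in> pos_orthant" for n
    by (intro real_vec_pos_orthant cell_pos_lattice x)
  have scaled_pos: "(1 / real n) *\<^sub>R real_vec (cell n x) \<in> pos_orthant" if "n > 0" for n
    using pos[of n] that by (simp add: pos_orthant_def)
  have ev: "\<forall>\<^sub>F n in sequentially. (1 / real n) *\<^sub>R real_vec (cell n x) \<in> pos_orthant"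
    using eventually_gt_at_top[of 0] by eventually_elim (rule scaled_pos)
  have "(\<lambda>n. g ((1 / real n) *\<^sub>R real_vec (cell n x))) \<longlonglongrightarrow> g x"
    by (rule continuous_within_tendsto_compose[OF cont ev cell_scaled_tendsto])
  from tendsto_mult[OF this L_lim]
  have "(\<lambda>n. g ((1 / real n) *\<^sub>R real_vec (cell n x)) * L (cell n x)) \<longlonglongrightarrow> g x" by simp
  moreover have "\<forall>\<^sub>F n in sequentially. g ((1 / real n) *\<^sub>R real_vec (cell n x)) * L (cell n x)
      = real n powr (- \<alpha>) * (g (real_vec (cell n x)) * L (cell n x))"
    using eventually_gt_at_top[of 0]
  proof eventually_elim
    case (elim n)
    have "g ((1 / real n) *\<^sub>R real_vec (cell n x)) = (1 / real n) powr \<alpha> * g (real_vec (cell n x))"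
      using elim pos by (intro homogeneous) auto
    also have "(1 / real n) powr \<alpha> = real n powr (- \<alpha>)"
      using elim by (simp add: powr_divide powr_minus_divide)
    finally show ?case by simp
  qed
  ultimately show ?thesis
    by (rule Lim_transform_eventually)
qed

lemma AE_continuous_perms:
  "AE x in lebesgue. x \<in> pos_orthant \<longrightarrow> (\<forall>\<sigma>\<in>perms. continuous (at (perm_vec \<sigma> x) within pos_orthant) g)"
proof -
  have "AE x in lebesgue. \<forall>\<sigma>\<in>(perms :: ('k \<Rightarrow> 'k) set). perm_vec \<sigma> x \<in> pos_orthant \<longrightarrow>
      continuous (at (perm_vec \<sigma> x) within pos_orthant) g"
    by (rule AE_finite_allI) (auto intro!: AE_lebesgue_perm_vec[OF AE_continuous])
  then show ?thesis
    by eventually_elim (auto intro: perm_vec_pos_orthant)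
qed

lemma sym_coeff_cell_tendsto:
  assumes L: "admissible_factor L"
  shows "AE x in lebesgue. x \<in> pos_orthant \<longrightarrow>
    (\<lambda>n. real n powr (- \<alpha>) * sym_coeff (\<lambda>i. g (real_vec i) * L i) (cell n x)) \<longlonglongrightarrow> symmetrization g x"
  using AE_continuous_perms
proof eventually_elim
  case (elim x)
  show ?case
  proof
    assume x: "x \<in> pos_orthant"
    have "(\<lambda>n. 1 / fact CARD('k) * (\<Sum>\<sigma>\<in>perms. real n powr (- \<alpha>) *
        (g (real_vec (cell n (perm_vec \<sigma> x))) * L (cell n (perm_vec \<sigma> x)))))
      \<longlonglongrightarrow> 1 / fact CARD('k) * (\<Sum>\<sigma>\<in>perms. g (perm_vec \<sigma> x))"
      using elim x
      by (intro tendsto_mult_left tendsto_sum kernel_cell_tendsto[OF _ _ L] perm_vec_pos_orthant) auto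
    then show "(\<lambda>n. real n powr (- \<alpha>) * sym_coeff (\<lambda>i. g (real_vec i) * L i) (cell n x)) \<longlonglongrightarrow> symmetrization g x"
      by (simp add: sym_coeff_def symmetrization_eq perm_vec_cell sum_distrib_left mult_ac)
  qed
qed

lemma symmetrization_homogeneous:
  assumes "0 < c" "x \<in> pos_orthant"
  shows "symmetrization g (c *\<^sub>R x) = c powr \<alpha> * symmetrization g x"
proof -
  have "perm_vec \<sigma> (c *\<^sub>R x) = c *\<^sub>R perm_vec \<sigma> x" for \<sigma>
    by (simp add: vec_eq_iff)
  then show ?thesis
    using assms by (simp add: symmetrization_eq homogeneous perm_vec_pos_orthant sum_distrib_left mult_ac)
qed

lemma symmetrization_AE_continuous:
  "AE x in lebesgue. x \<in> pos_orthant \<longrightarrow> continuous (at x within pos_orthant) (symmetrization g)"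
  using AE_continuous_perms
proof eventually_elim
  case (elim x)
  show ?case
  proof
    assume x: "x \<in> pos_orthant"
    have "continuous (at x within pos_orthant) (\<lambda>z. g (perm_vec \<sigma> z))" if "\<sigma> \<in> perms" for \<sigma>
    proof -
      have "linear (perm_vec \<sigma> :: real ^ 'k \<Rightarrow> real ^ 'k)"
        by (intro linearI) (simp_all add: vec_eq_iff)
      then have "continuous (at x within pos_orthant) (perm_vec \<sigma>)"
        using linear_continuous_at linear_conv_bounded_linear continuous_at_imp_continuous_within by blast
      moreover have "perm_vec \<sigma> ` pos_orthant \<subseteq> (pos_orthant :: (real ^ 'k) set)"
        using perm_vec_pos_orthant by blast
      moreover have "continuous (at (perm_vec \<sigma> x) within pos_orthant) g"
        using elim x that by blast
      then have "continuous (at (perm_vec \<sigma> x) within perm_vec \<sigma> ` pos_orthant) g"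
        using calculation(2) by (rule continuous_within_subset)
      with calculation(1) show ?thesis
        by (rule continuous_within_compose2)
    qed
    then show "continuous (at x within pos_orthant) (symmetrization g)"
      unfolding symmetrization_eq[abs_def] by (intro continuous_intros) auto
  qed
qed

end

section \<open>Positivity of the constant\<close>

text \<open>Extending the coefficients by 0 turns the sum over positive multi-indices into a sum over the
  whole lattice, which is translation invariant; so the sum depends only on the lag. The restriction
  to distinct entries is compatible with this, since translation along the diagonal preserves it.\<close>
lemma (in power_dominated) has_sum_lag_UNIV:
  defines "A0 \<equiv> \<lambda>i. if i \<in> offdiag_lattice then A i else 0"
  shows "((\<lambda>i. A0 (shift_vec n i) * A0 (shift_vec m i)) has_sum R \<bar>n - m\<bar>) UNIV"
proof -
  have ordered: "((\<lambda>i. A0 (shift_vec n i) * A0 (shift_vec m i)) has_sum R \<bar>n - m\<bar>) UNIV" if "m \<le> n" for n m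
  proof -
    have "((\<lambda>i. A i * A (shift_vec (n - m) i)) has_sum R (n - m)) offdiag_lattice"
      using that by (intro has_sum_R) simp
    moreover have "((\<lambda>i. A i * A (shift_vec (n - m) i)) has_sum R (n - m)) offdiag_lattice
        \<longleftrightarrow> ((\<lambda>i. A0 i * A0 (shift_vec (n - m) i)) has_sum R (n - m)) UNIV"
      using that shift_vec_offdiag[of "n - m"]
      by (intro has_sum_cong_neutral) (auto simp: A0_def)
    ultimately have "((\<lambda>i. A0 i * A0 (shift_vec (n - m) i)) has_sum R (n - m)) UNIV"
      by simp
    moreover have "bij_betw (shift_vec m) (UNIV :: (int ^ 'k) set) UNIV"
      by (rule bij_betw_byWitness[where f' = "shift_vec (- m)"]) (auto simp: vec_eq_iff)
    ultimately have "((\<lambda>i. A0 (shift_vec m i) * A0 (shift_vec (n - m) (shift_vec m i))) has_sum R (n - m)) UNIV"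
      using has_sum_reindex_bij_betw[of "shift_vec m" UNIV UNIV "\<lambda>i. A0 i * A0 (shift_vec (n - m) i)"]
      by blast
    moreover have "shift_vec (n - m) (shift_vec m i) = shift_vec n i" for i :: "int ^ 'k"
      by (simp add: vec_eq_iff)
    ultimately show ?thesis
      using that by (simp add: mult.commute)
  qed
  show ?thesis
  proof (cases "m \<le> n")
    case False
    then have "((\<lambda>i. A0 (shift_vec m i) * A0 (shift_vec n i)) has_sum R \<bar>m - n\<bar>) UNIV"
      by (intro ordered) simp
    then show ?thesis by (simp add: mult.commute abs_minus_commute)
  qed (rule ordered)
qed

text \<open>The double sum over lags is a sum of squares over the whole lattice; keeping only the terms in
  \<open>B\<close> bounds it from below.\<close>
lemma (in power_dominated) variance_sum_ge:
  assumes "finite B"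
  shows "(\<Sum>i\<in>B. (\<Sum>n=1..N. if shift_vec (int n) i \<in> offdiag_lattice then A (shift_vec (int n) i) else 0)\<^sup>2)
    \<le> variance_sum R N"
proof -
  define A0 where "A0 i = (if i \<in> offdiag_lattice then A i else 0)" for i
  have "((\<lambda>i. \<Sum>n=1..N. \<Sum>m=1..N. A0 (shift_vec (int n) i) * A0 (shift_vec (int m) i))
      has_sum (\<Sum>n=1..N. \<Sum>m=1..N. R \<bar>int n - int m\<bar>)) UNIV"
    unfolding A0_def by (intro has_sum_finite_sum has_sum_lag_UNIV) auto
  then have "((\<lambda>i. (\<Sum>n=1..N. A0 (shift_vec (int n) i))\<^sup>2) has_sum variance_sum R N) UNIV"
    by (simp add: power2_eq_square sum_product variance_sum_def)
  then have "(\<Sum>i\<in>B. (\<Sum>n=1..N. A0 (shift_vec (int n) i))\<^sup>2) \<le> variance_sum R N"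
    using assms by (rule finite_sum_le_has_sum) auto
  then show ?thesis by (simp add: A0_def)
qed

lemma finite_card_int_box:
  fixes b :: "int ^ 'k::finite"
  shows "finite {i. \<forall>j. b $ j \<le> i $ j \<and> i $ j < b $ j + int N}" (is "finite ?B")
    and "card {i. \<forall>j. b $ j \<le> i $ j \<and> i $ j < b $ j + int N} = N ^ CARD('k)"
proof -
  have B: "?B = (\<lambda>f. \<chi> j. f j) ` (PiE UNIV (\<lambda>j. {b $ j ..< b $ j + int N}))" (is "_ = _ ` ?P")
  proof
    show "?B \<subseteq> (\<lambda>f. \<chi> j. f j) ` ?P"
    proof
      fix i assume "i \<in> ?B"
      then show "i \<in> (\<lambda>f. \<chi> j. f j) ` ?P"
        by (intro image_eqI[of _ _ "\<lambda>j. i $ j"]) (auto simp: vec_eq_iff)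
    qed
  qed (auto simp: PiE_def Pi_def)
  have fin: "finite ?P" by (rule finite_PiE) auto
  then show "finite ?B" unfolding B by (rule finite_imageI)
  have "inj_on (\<lambda>f. \<chi> j. f j) ?P"
    by (auto simp: inj_on_def vec_eq_iff)
  then have "card ?B = card ?P" unfolding B by (rule card_image)
  also have "\<dots> = N ^ CARD('k)" by (simp add: card_PiE)
  finally show "card ?B = N ^ CARD('k)" .
qed

text \<open>Almost every point is a point of continuity with distinct coordinates, and \<open>f\<close> is nonzero on a
  set of positive measure, so some point has all three properties; they persist on a small box.
  The sign of \<open>f\<close> there is \<open>s\<close>.\<close>
lemma nonzero_on_box:
  fixes f :: "real ^ 'k::finite \<Rightarrow> real"
  assumes cont: "AE x in lebesgue. x \<in> pos_orthant \<longrightarrow> continuous (at x within pos_orthant) f"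
    and nonzero: "\<not> (AE x in lebesgue. x \<in> pos_orthant \<longrightarrow> f x = 0)"
  obtains x t s \<delta> where "x \<in> pos_orthant" "0 < t" "\<bar>s\<bar> = (1::real)" "0 < \<delta>"
    "\<forall>z. (\<forall>j. x $ j \<le> z $ j \<and> z $ j \<le> x $ j + 2 * t) \<longrightarrow> \<delta> \<le> s * f z \<and> inj (\<lambda>j. z $ j)"
proof -
  have "\<exists>x. x \<in> pos_orthant \<and> f x \<noteq> 0 \<and> continuous (at x within pos_orthant) f \<and> inj (\<lambda>j. x $ j)"
  proof (rule ccontr)
    assume none: "\<not> ?thesis"
    have "AE x in lebesgue. x \<in> pos_orthant \<longrightarrow> f x = 0"
      using cont AE_lebesgue_inj_nth by eventually_elim (use none in blast)
    then show False using nonzero by blast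
  qed
  then obtain x where x: "x \<in> pos_orthant" and fx: "f x \<noteq> 0"
    and cx: "continuous (at x within pos_orthant) f" and ix: "inj (\<lambda>j. x $ j)" by blast
  define s where "s = sgn (f x)"
  define \<delta> where "\<delta> = \<bar>f x\<bar> / 2"
  have \<delta>: "0 < \<delta>" using fx by (simp add: \<delta>_def)
  have sfx: "s * f x = \<bar>f x\<bar>" by (simp add: s_def sgn_mult_self_eq abs_sgn mult.commute)
  have lim_f: "((\<lambda>z. s * f z) \<longlongrightarrow> s * f x) (at x within pos_orthant)"
    using cx unfolding continuous_within by (rule tendsto_mult_left)
  have "\<forall>\<^sub>F z in at x within pos_orthant. \<delta> < s * f z"
    using \<delta> by (intro order_tendstoD(1)[OF lim_f]) (simp add: sfx \<delta>_def)
  moreover have "\<forall>\<^sub>F z in at x within pos_orthant. \<forall>p q. p \<noteq> q \<longrightarrow> z $ p - z $ q \<noteq> 0"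
  proof -
    have "\<forall>\<^sub>F z in at x within pos_orthant. p \<noteq> q \<longrightarrow> z $ p - z $ q \<noteq> 0" for p q
    proof (cases "p = q")
      case False
      have "((\<lambda>z. z $ p - z $ q) \<longlongrightarrow> x $ p - x $ q) (at x within pos_orthant)"
        by (intro tendsto_intros)
      moreover have "x $ p - x $ q \<noteq> 0" using ix False by (auto simp: inj_def)
      ultimately have "\<forall>\<^sub>F z in at x within pos_orthant. z $ p - z $ q \<noteq> 0"
        by (rule tendsto_imp_eventually_ne)
      then show ?thesis by (rule eventually_mono) simp
    qed simp
    then show ?thesis by (simp only: eventually_all_finite)
  qed
  ultimately have "\<forall>\<^sub>F z in at x within pos_orthant. \<delta> < s * f z \<and> (\<forall>p q. p \<noteq> q \<longrightarrow> z $ p - z $ q \<noteq> 0)"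
    by (rule eventually_conj)
  then obtain d where d: "d > 0" and near': "\<forall>z\<in>pos_orthant. z \<noteq> x \<and> dist z x < d \<longrightarrow>
      \<delta> < s * f z \<and> (\<forall>p q. p \<noteq> q \<longrightarrow> z $ p - z $ q \<noteq> 0)"
    unfolding eventually_at by (elim exE conjE)
  have near: "\<delta> < s * f z \<and> (\<forall>p q. p \<noteq> q \<longrightarrow> z $ p - z $ q \<noteq> 0)"
    if "z \<in> pos_orthant" "z \<noteq> x" "dist z x < d" for z
    using that(2,3) by (intro mp[OF bspec[OF near' that(1)]] conjI)
  \<comment> \<open>The \<open>l\<^sup>1\<close> diameter of the box \<open>[x, x + 2t]\<close> is then \<open>d/2\<close>.\<close>
  define t where "t = d / (4 * real CARD('k))"
  have t: "t > 0" using d by (simp add: t_def)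
  show ?thesis
  proof (rule that[OF x t _ \<delta>]; (intro allI impI)?)
    show "\<bar>s\<bar> = 1" using fx by (simp add: s_def abs_sgn_eq)
    fix z assume z': "\<forall>j. x $ j \<le> z $ j \<and> z $ j \<le> x $ j + 2 * t"
    then have z: "x $ j \<le> z $ j \<and> z $ j \<le> x $ j + 2 * t" for j by blast
    have "0 < z $ j" for j
    proof -
      have "0 < x $ j" using x by (simp add: pos_orthant_def)
      then show ?thesis using z[of j] by linarith
    qed
    then have zpos: "z \<in> pos_orthant" by (simp add: pos_orthant_def)
    have "dist z x \<le> (\<Sum>j\<in>UNIV. \<bar>(z - x) $ j\<bar>)"
      unfolding dist_norm by (rule norm_le_l1_cart)
    also have "\<dots> \<le> (\<Sum>j\<in>(UNIV :: 'k set). 2 * t)"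
    proof (rule sum_mono)
      fix j show "\<bar>(z - x) $ j\<bar> \<le> 2 * t" using z[of j] by simp
    qed
    also have "\<dots> = d / 2" by (simp add: t_def)
    also have "\<dots> < d" using d by simp
    finally have "dist z x < d" .
    then show "\<delta> \<le> s * f z \<and> inj (\<lambda>j. z $ j)"
    proof (cases "z = x")
      case True
      then show ?thesis using ix fx by (simp add: sfx \<delta>_def)
    next
      case False
      have "\<delta> < s * f z \<and> (\<forall>p q. p \<noteq> q \<longrightarrow> z $ p - z $ q \<noteq> 0)"
        using \<open>dist z x < d\<close> by (intro near[OF zpos False])
      then show ?thesis by (auto simp only: inj_def right_minus_eq less_imp_le)
    qed
  qed
qed

lemma admissible_factor_one: "admissible_factor (\<lambda>_. 1)"
  by (auto simp: admissible_factor_def)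

text \<open>The bound of \<open>nonzero_on_box\<close> is transported to scale \<open>N\<close> by homogeneity: if the entries of \<open>i\<close>
  lie within \<open>N\<close> above those of \<open>c x\<close>, where \<open>c = N / t\<close>, and \<open>n \<le> N\<close>, then \<open>(i + n) / c\<close> lies in the
  box \<open>[x, x + 2t]\<close>.\<close>
theorem (in homogeneous_kernel) kernel_constant_pos:
  assumes \<alpha>: "\<alpha> \<in> {- (real CARD('k) + 1) / 2 <..< - real CARD('k) / 2}"
    and dom: "lattice_dominated \<alpha> g"
    and nonzero: "\<not> (AE x in lebesgue. x \<in> pos_orthant \<longrightarrow> symmetrization g x = 0)"
  shows "0 < kernel_constant (symmetrization g)"
proof -
  let ?f = "symmetrization g"
  define p where "p = 2 * \<alpha> + real CARD('k)"
  have p: "-1 < p" "p < 0" using \<alpha> by (simp_all add: p_def field_simps)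
  define A where "A = sym_coeff (\<lambda>i. g (real_vec i) * 1)"
  obtain K \<Delta> where "power_dominated \<alpha> K \<Delta> A"
    unfolding A_def by (rule power_dominated_sym_coeff[OF dom admissible_factor_one])
  then interpret power_dominated \<alpha> K \<Delta> A .
  have A_eq: "A i = ?f (real_vec i)" for i
    by (simp add: A_def sym_coeff_def symmetrization_eq perm_vec_real_vec)
  have "(\<lambda>n. real n powr (- 2 * \<alpha> - real CARD('k)) * R (int n)) \<longlonglongrightarrow> kernel_constant ?f"
    using sym_coeff_cell_tendsto[OF admissible_factor_one] unfolding A_def[symmetric]
    by (rule R_asymptotics)
  moreover have "real n powr (- 2 * \<alpha> - real CARD('k)) * R (int n) = R (int n) / real n powr p" for n
  proof -
    have "- 2 * \<alpha> - real CARD('k) = - p" by (simp add: p_def)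
    then show ?thesis by (simp add: powr_minus_divide)
  qed
  ultimately have "(\<lambda>n. R (int n) / real n powr p) \<longlonglongrightarrow> kernel_constant ?f" by simp
  from variance_sum_asymptotics[OF p this]
  have V_lim: "(\<lambda>N. variance_sum R N / real N powr (p + 2)) \<longlonglongrightarrow> 2 * kernel_constant ?f / ((p + 1) * (p + 2))" .

  obtain x t s \<delta> where x: "x \<in> pos_orthant" and t: "0 < t" and s: "\<bar>s\<bar> = 1" and \<delta>: "0 < \<delta>"
    and box: "\<forall>z. (\<forall>j. x $ j \<le> z $ j \<and> z $ j \<le> x $ j + 2 * t) \<longrightarrow> \<delta> \<le> s * ?f z \<and> inj (\<lambda>j. z $ j)"
    by (rule nonzero_on_box[OF symmetrization_AE_continuous nonzero])
  define \<eta> where "\<eta> = (1 / t) powr \<alpha> * \<delta>"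
  have \<eta>: "\<eta> > 0" using t \<delta> by (simp add: \<eta>_def)
  have lower: "\<eta>\<^sup>2 \<le> variance_sum R N / real N powr (p + 2)" if N: "N > 0" for N
  proof -
    \<comment> \<open>The box \<open>B\<close> has exactly \<open>N\<^sup>k\<close> points, whatever the fractional parts of its lower corner are.\<close>
    define b where "b = (\<chi> j. \<lceil>real N * (x $ j / t)\<rceil>)"
    define B where "B = {i :: int ^ 'k. \<forall>j. b $ j \<le> i $ j \<and> i $ j < b $ j + int N}"
    define c where "c = real N / t"
    have c: "c > 0" using N t by (simp add: c_def)
    have summand: "shift_vec (int n) i \<in> offdiag_lattice \<and> real N powr \<alpha> * \<eta> \<le> s * A (shift_vec (int n) i)"
      if i: "i \<in> B" and n: "n \<in> {1..N}" for i n
    proof -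
      define z where "z = (1 / c) *\<^sub>R real_vec (shift_vec (int n) i)"
      have z: "x $ j \<le> z $ j \<and> z $ j \<le> x $ j + 2 * t" for j
      proof -
        have "b $ j \<le> i $ j" "i $ j \<le> b $ j + int N - 1" using i by (auto simp: B_def)
        moreover have "c * x $ j \<le> of_int (b $ j)" "of_int (b $ j) < c * x $ j + 1"
          unfolding b_def c_def by (simp_all add: ceiling_correct mult.commute) linarith+
        ultimately have "c * x $ j \<le> of_int (i $ j) + real n" "of_int (i $ j) + real n \<le> c * x $ j + 2 * real N"
          using n by (simp_all add: of_int_le_iff[symmetric, where 'a = real] del: of_int_le_iff)
        moreover have "2 * real N = c * (2 * t)" using t by (simp add: c_def)
        ultimately show ?thesis
          using c by (simp add: z_def field_simps)
      qed
      then have fz: "\<delta> \<le> s * ?f z" and inj: "inj (\<lambda>j. z $ j)"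
        using box by blast+
      have "0 < z $ j" for j
      proof -
        have "0 < x $ j" using x by (simp add: pos_orthant_def)
        then show ?thesis using z[of j] by linarith
      qed
      then have zpos: "z \<in> pos_orthant" by (simp add: pos_orthant_def)
      have vec: "real_vec (shift_vec (int n) i) = c *\<^sub>R z"
        using c by (simp add: z_def)
      have coord: "of_int (shift_vec (int n) i $ j) = c * z $ j" for j
        using arg_cong[OF vec, of "\<lambda>v. v $ j"] by simp
      have "shift_vec (int n) i \<in> offdiag_lattice"
        unfolding offdiag_lattice_iff
      proof
        show "\<forall>j. 0 < shift_vec (int n) i $ j"
        proof
          fix j
          have "0 < c * z $ j" using c zpos by (simp add: pos_orthant_def)
          then show "0 < shift_vec (int n) i $ j"
            unfolding coord[symmetric] by (simp only: of_int_0_less_iff)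
        qed
        show "inj (\<lambda>j. shift_vec (int n) i $ j)"
        proof (rule injI)
          fix l m assume "shift_vec (int n) i $ l = shift_vec (int n) i $ m"
          then have "c * z $ l = c * z $ m" unfolding coord[symmetric] by simp
          then show "l = m" using c inj by (simp add: inj_def)
        qed
      qed
      moreover have "A (shift_vec (int n) i) = c powr \<alpha> * ?f z"
        unfolding A_eq vec by (rule symmetrization_homogeneous[OF c zpos])
      moreover have "c powr \<alpha> = real N powr \<alpha> * (1 / t) powr \<alpha>"
        using t unfolding c_def by (simp add: powr_mult[symmetric])
      ultimately show ?thesis
        using mult_left_mono[OF fz, of "c powr \<alpha>"] by (simp add: \<eta>_def mult_ac)
    qed
    have sq: "(real N * (real N powr \<alpha> * \<eta>))\<^sup>2
        \<le> (\<Sum>n=1..N. if shift_vec (int n) i \<in> offdiag_lattice then A (shift_vec (int n) i) else 0)\<^sup>2"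
      (is "_ \<le> ?S\<^sup>2") if "i \<in> B" for i
    proof -
      have "real N * (real N powr \<alpha> * \<eta>) = (\<Sum>n=1..N. real N powr \<alpha> * \<eta>)" by simp
      also have "\<dots> \<le> (\<Sum>n=1..N. s * (if shift_vec (int n) i \<in> offdiag_lattice then A (shift_vec (int n) i) else 0))"
        using summand[OF that] by (intro sum_mono) simp
      also have "\<dots> = s * ?S" by (simp only: sum_distrib_left)
        also have "\<dots> \<le> \<bar>?S\<bar>"
        proof -
          have "\<bar>s * ?S\<bar> = \<bar>?S\<bar>" by (simp only: abs_mult s mult_1)
          then show ?thesis using abs_ge_self[of "s * ?S"] by linarith
        qed
      finally show ?thesis
        using \<eta> by (simp add: abs_le_square_iff[symmetric])
    qed
    have "real N ^ CARD('k) * (real N * (real N powr \<alpha> * \<eta>))\<^sup>2 = (\<Sum>i\<in>B. (real N * (real N powr \<alpha> * \<eta>))\<^sup>2)"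
      using finite_card_int_box(2)[of b N] by (simp add: B_def)
    also have "\<dots> \<le> (\<Sum>i\<in>B. (\<Sum>n=1..N. if shift_vec (int n) i \<in> offdiag_lattice then A (shift_vec (int n) i) else 0)\<^sup>2)"
      by (rule sum_mono[OF sq])
    also have "\<dots> \<le> variance_sum R N"
      using finite_card_int_box(1)[of b N] by (intro variance_sum_ge) (simp add: B_def)
    also have "real N ^ CARD('k) * (real N * (real N powr \<alpha> * \<eta>))\<^sup>2 = real N powr (p + 2) * \<eta>\<^sup>2"
    proof -
      have "real N ^ CARD('k) * (real N * (real N powr \<alpha> * \<eta>))\<^sup>2
          = (real N powr real CARD('k) * (real N powr 1 * real N powr 1) * (real N powr \<alpha> * real N powr \<alpha>)) * \<eta>\<^sup>2"
        using N by (simp add: powr_realpow power2_eq_square)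
      also have "\<dots> = real N powr (p + 2) * \<eta>\<^sup>2"
        unfolding powr_add[symmetric] by (simp add: p_def algebra_simps)
      finally show ?thesis .
    qed
    finally show ?thesis
      using N by (simp add: field_simps)
  qed
  have "\<eta>\<^sup>2 \<le> 2 * kernel_constant ?f / ((p + 1) * (p + 2))"
  proof (rule tendsto_lowerbound[OF V_lim])
    show "\<forall>\<^sub>F N in sequentially. \<eta>\<^sup>2 \<le> variance_sum R N / real N powr (p + 2)"
      by (rule eventually_mono[OF eventually_gt_at_top[of 0]]) (rule lower)
  qed simp
  moreover have "0 < \<eta>\<^sup>2" using \<eta> by simp
  ultimately have "0 < 2 * kernel_constant ?f / ((p + 1) * (p + 2))" by linarith
  moreover have "0 < (p + 1) * (p + 2)" using p by simp
  ultimately show ?thesis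
    by (simp add: zero_less_divide_iff)
qed

section \<open>Covariance and variance asymptotics\<close>

theorem proposition4p4:
  fixes M :: "'a measure"
    and \<epsilon> X :: "int \<Rightarrow> 'a \<Rightarrow> real"
    and g :: "real ^ 'k::finite \<Rightarrow> real"
    and L :: "int ^ 'k \<Rightarrow> real"
    and \<alpha> H C :: real
  assumes "prob_space M"
    and "iid_standardized M \<epsilon>"
    and "generalized_hermite_kernel \<alpha> g"
    and "class_L \<alpha> g"
    and "lattice_dominated \<alpha> g"
    and "\<not> (AE x in lebesgue. x \<in> pos_orthant \<longrightarrow> symmetrization g x = 0)"
    and "admissible_factor L"
    and "causal_discrete_chaos M \<epsilon> (\<lambda>i. g (real_vec i) * L i) X"
    and "H = \<alpha> + real CARD('k) / 2 + 1"
    and "C = kernel_constant (symmetrization g)"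
  shows "H \<in> {1/2 <..< 1} \<and> C > 0 \<and>
    (\<lambda>n::nat. covariance M (X (int n)) (X 0))
       \<sim>[at_top] (\<lambda>n. fact CARD('k) * C * real n powr (2 * H - 2)) \<and>
    (\<lambda>N::nat. prob_space.variance M (\<lambda>\<omega>. \<Sum>n = 1..N. X (int n) \<omega>))
       \<sim>[at_top] (\<lambda>N. fact CARD('k) * C / (H * (2 * H - 1)) * real N powr (2 * H))"
proof -
  define a where "a i = g (real_vec i) * L i" for i
  interpret prob_space M by (rule assms(1))
  interpret chaos_process M \<epsilon> a X
    using assms(2,8) by unfold_locales (simp_all add: a_def[abs_def])
  interpret homogeneous_kernel \<alpha> g
    using assms(3,4) by unfold_locales (auto simp: generalized_hermite_kernel_def class_L_def)
  have \<alpha>: "\<alpha> \<in> {- (real CARD('k) + 1) / 2 <..< - real CARD('k) / 2}"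
    using assms(3) by (simp add: generalized_hermite_kernel_def)
  have H: "1 / 2 < H" "H < 1" using \<alpha> by (simp_all add: assms(9) field_simps)
  have C: "C > 0"
    unfolding assms(10) by (rule kernel_constant_pos[OF \<alpha> assms(5,6)])
  obtain K \<Delta> where "power_dominated \<alpha> K \<Delta> (sym_coeff a)"
    unfolding a_def[abs_def] by (rule power_dominated_sym_coeff[OF assms(5,7)])
  then interpret A: power_dominated \<alpha> K \<Delta> "sym_coeff a" .
  let ?k = "fact CARD('k) :: real"

  have EXX: "expectation (\<lambda>\<omega>. X (m + n) \<omega> * X m \<omega>) = ?k * A.R n" if "0 \<le> n" for m n
  proof -
    have "((\<lambda>i. ?k * (sym_coeff a i * sym_coeff a (shift_vec n i)))
        has_sum expectation (\<lambda>\<omega>. X (m + n) \<omega> * X m \<omega>)) offdiag_lattice"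
      by (rule has_sum_symmetrize[OF expectation_X_mult_X[OF that]])
    moreover have "((\<lambda>i. ?k * (sym_coeff a i * sym_coeff a (shift_vec n i))) has_sum (?k * A.R n)) offdiag_lattice"
      by (rule has_sum_cmult_right[OF A.has_sum_R[OF that]])
    ultimately show ?thesis by (rule has_sum_unique)
  qed
  have EXX': "expectation (\<lambda>\<omega>. X n \<omega> * X m \<omega>) = ?k * A.R \<bar>n - m\<bar>" for n m
    using EXX[of "n - m" m] EXX[of "m - n" n] by (cases "m \<le> n") (simp_all add: mult.commute)
  have cov: "covariance M (X (int n)) (X 0) = ?k * A.R (int n)" for n
    using EXX'[of "int n" 0] by (simp add: covariance_def expectation_X)
  have var: "variance (\<lambda>\<omega>. \<Sum>n = 1..N. X (int n) \<omega>) = ?k * variance_sum A.R N" for N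
  proof -
    have int: "integrable M (\<lambda>\<omega>. X n \<omega> * X m \<omega>)" for n m
      by (intro integrable_mult_of_square_integrable X_square_integrable) auto
    have "expectation (\<lambda>\<omega>. \<Sum>n = 1..N. X (int n) \<omega>) = 0"
      by (simp add: Bochner_Integration.integral_sum X_integrable expectation_X)
    then have "variance (\<lambda>\<omega>. \<Sum>n = 1..N. X (int n) \<omega>)
        = expectation (\<lambda>\<omega>. \<Sum>n = 1..N. \<Sum>m = 1..N. X (int n) \<omega> * X (int m) \<omega>)"
      by (simp add: power2_eq_square sum_product)
    also have "\<dots> = (\<Sum>n = 1..N. \<Sum>m = 1..N. ?k * A.R \<bar>int n - int m\<bar>)"
      using int by (simp add: Bochner_Integration.integral_sum EXX')
    also have "\<dots> = ?k * variance_sum A.R N"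
      by (simp add: variance_sum_def sum_distrib_left)
    finally show ?thesis .
  qed

  define p where "p = 2 * H - 2"
  have p: "-1 < p" "p < 0" using H by (simp_all add: p_def)
  have "(\<lambda>n. real n powr (- 2 * \<alpha> - real CARD('k)) * A.R (int n)) \<longlonglongrightarrow> C"
    unfolding assms(10)
    by (rule A.R_asymptotics) (use sym_coeff_cell_tendsto[OF assms(7)] in \<open>simp add: a_def[abs_def]\<close>)
  moreover have "real n powr (- 2 * \<alpha> - real CARD('k)) * A.R (int n) = A.R (int n) / real n powr p" for n
  proof -
    have "- 2 * \<alpha> - real CARD('k) = - p" by (simp add: p_def assms(9))
    then show ?thesis by (simp add: powr_minus_divide)
  qed
  ultimately have R_lim: "(\<lambda>n. A.R (int n) / real n powr p) \<longlonglongrightarrow> C" by simp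

  have "(\<lambda>n::nat. covariance M (X (int n)) (X 0)) \<sim>[at_top] (\<lambda>n. ?k * C * real n powr p)"
  proof (rule asymp_equivI'_const)
    show "(\<lambda>n. covariance M (X (int n)) (X 0) / real n powr p) \<longlonglongrightarrow> ?k * C"
      using tendsto_mult_left[OF R_lim, of ?k] by (simp add: cov)
    show "?k * C \<noteq> 0" using C by simp
  qed
  moreover have "(\<lambda>N::nat. variance (\<lambda>\<omega>. \<Sum>n = 1..N. X (int n) \<omega>))
      \<sim>[at_top] (\<lambda>N. ?k * C / (H * (2 * H - 1)) * real N powr (2 * H))"
  proof (rule asymp_equivI'_const)
    have "2 * C / ((p + 1) * (p + 2)) = C / (H * (2 * H - 1))"
      using H by (simp add: p_def field_simps)
    then have "(\<lambda>N. variance_sum A.R N / real N powr (2 * H)) \<longlonglongrightarrow> C / (H * (2 * H - 1))"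
      using variance_sum_asymptotics[OF p R_lim] by (simp add: p_def mult.commute)
    from tendsto_mult_left[OF this, of ?k]
    show "(\<lambda>N. variance (\<lambda>\<omega>. \<Sum>n = 1..N. X (int n) \<omega>) / real N powr (2 * H))
        \<longlonglongrightarrow> ?k * C / (H * (2 * H - 1))"
      by (simp only: var times_divide_eq_right)
    show "?k * C / (H * (2 * H - 1)) \<noteq> 0" using C H by simp
  qed
  ultimately show ?thesis
    using H C by (simp add: p_def)
qed

end
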